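(* Let $\mathcal{K}$ be the symmetric cone (cone of squares) of a Euclidean Jordan algebra $\mathcal{E}$, $\mathcal{L}\subseteq\mathcal{E}$ a subspace and $a\in\mathcal{E}$ such that $\mathcal{K}\cap(\mathcal{L}+a)\ne\emptyset$. Let $\rho$ be a positive real number. Then there exists a positive constant $\kappa$ (depending on $\mathcal{K},\mathcal{L},a,\rho$) such that for every $x\in\mathcal{E}$ and $\epsilon\le1$ satisfying $$\operatorname{dist}(x,\mathcal{K})\le\epsilon,\qquad\operatorname{dist}(x,\mathcal{L}+a)\le\epsilon,\qquad\|x\|\le\rho,$$ we have $$\operatorname{dist}\bigl(x,(\mathcal{L}+a)\cap\mathcal{K}\bigr)\le\kappa\,\epsilon^{(2^{-d_{\mathrm{PPS}}(\mathcal{L},a)})}.$$ Furthermore, the same statement is valid (for some positive constant $\kappa$ with the same dependence) if the inequality $\operatorname{dist}(x,\mathcal{K})\le\epsilon$ is replaced by $\lambda_{\min}(x)\ge-\epsilon$.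
   Context: A Euclidean Jordan algebra is a finite-dimensional real vector space $\mathcal{E}$ with a bilinear product $\circ$ (with identity element $e$) and an inner product such that $x\circ y=y\circ x$, $x\circ(x^2\circ y)=x^2\circ(x\circ y)$ with $x^2=x\circ x$, and $\langle x\circ y,z\rangle=\langle x,y\circ z\rangle$. Its cone of squares is $\mathcal{K}=\{x^2: x\in\mathcal{E}\}$, a symmetric cone. By the spectral theorem every $x$ is $\sum_{i=1}^r\lambda_ic_i$ with $c_i$ primitive idempotents, $c_i\circ c_j=0$ for $i\ne j$, $\sum c_i=e$, and unique real eigenvalues $\lambda_i$; $\lambda_{\min}(x)$ is the smallest eigenvalue and $\operatorname{tr}x=\sum_i\lambda_i$. Throughout, the inner product is $\langle x,y\rangle=\operatorname{tr}(x\circ y)$, with induced norm $\|x\|=\sqrt{\operatorname{tr}(x^2)}$, and $\operatorname{dist}(x,C)=\inf\{\|x-y\|:y\in C\}$. $C^*=\{x:\langle x,y\rangle\ge0\ \forall y\in C\}$, $C^\perp$ is the orthogonal complement, $\operatorname{ri}$ the relative interior. PPS (partial polyhedral Slater) condition: for a closed convex cone $\mathcal{C}\subseteq\mathcal{E}$, $(\mathcal{C},\mathcal{L},a)$ satisfies the PPS condition if $\mathcal{E}$ can be written as an orthogonal product $\mathcal{E}=\mathcal{E}^1\times\mathcal{E}^2$ (a factor may be $\{0\}$) with $\mathcal{C}=\mathcal{C}^1\times\mathcal{C}^2$, where $\mathcal{C}^i\subseteq\mathcal{E}^i$ are closed convex cones, $\mathcal{C}^2$ is polyhedral, and there is $(x_1,x_2)\in\mathcal{L}+a$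 with $x_1\in\operatorname{ri}\mathcal{C}^1$, $x_2\in\mathcal{C}^2$. (So it holds if $(\operatorname{ri}\mathcal{C})\cap(\mathcal{L}+a)\ne\emptyset$, or if $\mathcal{C}$ is polyhedral and $\mathcal{C}\cap(\mathcal{L}+a)\neq\emptyset$.) $d_{\mathrm{PPS}}(\mathcal{L},a)$ is the minimum $k\ge0$ for which there are $\mathcal{F}_1=\mathcal{K}$, $z_i\in\mathcal{F}_i^*\cap\mathcal{L}^\perp\cap\{a\}^\perp$, $\mathcal{F}_{i+1}=\mathcal{F}_i\cap\{z_i\}^\perp$ ($i=1,\dots,k$) with $(\mathcal{F}_{k+1},\mathcal{L},a)$ satisfying the PPS condition; it is finite when $\mathcal{K}\cap(\mathcal{L}+a)\ne\emptyset$. *)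

theory Defs
  imports "HOL-Analysis.Analysis"
begin

text \<open>
  The ambient inner product is the one of the type class. The locale asks only that it be
  associative; the normalisation \<open>x \<bullet> y = jtrace jp e (jp x y)\<close> is a separate hypothesis. The cone,
  the eigenvalues and the trace depend only on the product \<open>jp\<close> and its identity \<open>e\<close>.
\<close>

locale euclidean_jordan_algebra =
  fixes jp :: "'a::euclidean_space \<Rightarrow> 'a \<Rightarrow> 'a" and e :: 'a
  assumes bilinear_jp: "bilinear jp"
    and identity: "jp e x = x"
    and commute: "jp x y = jp y x"
    and jordan: "jp x (jp (jp x x) y) = jp (jp x x) (jp x y)"
    and inner_assoc: "jp x y \<bullet> z = x \<bullet> jp y z"

definition cone_of_squares :: "('a \<Rightarrow> 'a \<Rightarrow> 'a) \<Rightarrow> 'a set" where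
  "cone_of_squares jp = range (\<lambda>x. jp x x)"

definition idempotent :: "('a \<Rightarrow> 'a \<Rightarrow> 'a) \<Rightarrow> 'a \<Rightarrow> bool" where
  "idempotent jp c \<longleftrightarrow> jp c c = c"

definition primitive_idempotent :: "('a::real_vector \<Rightarrow> 'a \<Rightarrow> 'a) \<Rightarrow> 'a \<Rightarrow> bool" where
  "primitive_idempotent jp c \<longleftrightarrow>
     idempotent jp c \<and> c \<noteq> 0 \<and>
     \<not> (\<exists>c' c''. idempotent jp c' \<and> idempotent jp c'' \<and> c' \<noteq> 0 \<and> c'' \<noteq> 0 \<and> c = c' + c'')"

definition spectral_decomposition ::
    "('a::real_vector \<Rightarrow> 'a \<Rightarrow> 'a) \<Rightarrow> 'a \<Rightarrow> 'a \<Rightarrow> nat \<Rightarrow> (nat \<Rightarrow> real) \<Rightarrow> (nat \<Rightarrow> 'a) \<Rightarrow> bool" where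
  "spectral_decomposition jp e x r l c \<longleftrightarrow>
     (\<forall>i<r. primitive_idempotent jp (c i)) \<and>
     (\<forall>i<r. \<forall>j<r. i \<noteq> j \<longrightarrow> jp (c i) (c j) = 0) \<and>
     (\<Sum>i<r. c i) = e \<and>
     x = (\<Sum>i<r. l i *\<^sub>R c i)"

text \<open>
  In a Euclidean Jordan algebra a spectral decomposition always exists and its eigenvalues are
  unique up to order, so both descriptions below are proper.
\<close>

definition jtrace :: "('a::real_vector \<Rightarrow> 'a \<Rightarrow> 'a) \<Rightarrow> 'a \<Rightarrow> 'a \<Rightarrow> real" where
  "jtrace jp e x = (THE t. \<exists>r l c. spectral_decomposition jp e x r l c \<and> t = (\<Sum>i<r. l i))"

definition lambda_min :: "('a::real_vector \<Rightarrow> 'a \<Rightarrow> 'a) \<Rightarrow> 'a \<Rightarrow> 'a \<Rightarrow> real" where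
  "lambda_min jp e x =
     (THE m. \<exists>r l c. spectral_decomposition jp e x r l c \<and> m = Min (l ` {..<r}))"

definition dual_cone :: "'a::real_inner set \<Rightarrow> 'a set" where
  "dual_cone C = {x. \<forall>y\<in>C. x \<bullet> y \<ge> 0}"

definition translate :: "'a::real_vector set \<Rightarrow> 'a \<Rightarrow> 'a set" where
  "translate L a = (\<lambda>x. x + a) ` L"

text \<open>
  The orthogonal product is taken internally: \<open>E1\<close> and \<open>E2\<close> are orthogonal subspaces spanning the
  space, and the pair \<open>(u, v)\<close> is identified with \<open>u + v\<close>. Relative interior and polyhedrality of a
  subset of a subspace do not depend on whether it is viewed in the subspace or in the whole space.
\<close>

definition PPS :: "'a::euclidean_space set \<Rightarrow> 'a set \<Rightarrow> 'a \<Rightarrow> bool" where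
  "PPS C L a \<longleftrightarrow>
     (\<exists>E1 E2 C1 C2.
        subspace E1 \<and> subspace E2 \<and> (\<forall>u\<in>E1. \<forall>v\<in>E2. orthogonal u v) \<and>
        {u + v |u v. u \<in> E1 \<and> v \<in> E2} = UNIV \<and>
        C1 \<subseteq> E1 \<and> closed C1 \<and> convex C1 \<and> cone C1 \<and>
        C2 \<subseteq> E2 \<and> closed C2 \<and> convex C2 \<and> cone C2 \<and>
        C = {u + v |u v. u \<in> C1 \<and> v \<in> C2} \<and>
        polyhedron C2 \<and>
        (\<exists>x1 x2. x1 + x2 \<in> translate L a \<and> x1 \<in> rel_interior C1 \<and> x2 \<in> C2))"

definition facial_reduction_PPS ::
    "'a::euclidean_space set \<Rightarrow> 'a set \<Rightarrow> 'a \<Rightarrow> nat \<Rightarrow> bool" where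
  "facial_reduction_PPS K L a k \<longleftrightarrow>
     (\<exists>F z. F 1 = K \<and>
        (\<forall>i\<in>{1..k}. z i \<in> dual_cone (F i) \<inter> orthogonal_comp L \<inter> orthogonal_comp {a} \<and>
                    F (i + 1) = F i \<inter> orthogonal_comp {z i}) \<and>
        PPS (F (k + 1)) L a)"

text \<open>Meaningful only when some \<open>k\<close> qualifies, in particular when \<open>K \<inter> translate L a \<noteq> {}\<close>.\<close>

definition d_PPS :: "'a::euclidean_space set \<Rightarrow> 'a set \<Rightarrow> 'a \<Rightarrow> nat" where
  "d_PPS K L a = (LEAST k. facial_reduction_PPS K L a k)"

end

theory Submission
  imports Defs
begin

text \<open>
  Every face met by facial reduction has the form \<open>{y o y | y \<in> V}\<close> for a subspace \<open>V\<close>. If \<open>z\<close> lies in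
  the dual cone of such a face, then \<open>q(y) = \<langle>y o y, z\<rangle>\<close> is a positive semidefinite quadratic form on
  \<open>V\<close>, and the next face is \<open>{y o y | y \<in> V'}\<close> where \<open>V'\<close> is the kernel of \<open>q\<close>. Since \<open>q\<close> dominates a
  multiple of the squared distance to \<open>V'\<close>, a point \<open>f = y o y\<close> of the face is within a multiple of
  \<open>sqrt \<langle>f, z\<rangle>\<close> of the next face: each facial reduction step costs one square root, and neither Peirce
  decompositions nor self-duality of the intermediate faces are needed. At the last face, the PPS
  condition gives bounded linear regularity, via Hoffman's error bound for the polyhedral part. The
  spectral theorem is used only for self-duality of the cone of squares (so that facial reduction
  terminates) and to compare the smallest eigenvalue with the distance to the cone.
\<close>

section \<open>Error bounds for polyhedra\<close>

text \<open>What makes \<open>\<langle>f, z\<rangle>\<close> small at a point \<open>f\<close> of a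
  face lies outside the face: \<open>z\<close> is orthogonal to \<open>L\<close> and to
  \<open>a\<close>, so it vanishes on the whole affine space, and the inner product is at most
  \<open>norm z\<close> times the distance from \<open>f\<close> to that space. A point of the face
  at distance s from \<open>x\<close> thus yields a point of the next face at distance of order sqrt
  s. The factor sqrt (norm f) is one place where the bound on \<open>norm x\<close> enters; the
  other is the final regularity step, which moves towards a Slater point and pays in proportion to
  the distance from it. That step is linear in the residual, so the exponent counts only the
  exposing vectors. Both claims share one proof: the distance to the cone is bounded by
  \<open>M\<close> times epsilon, with \<open>M\<close> equal to 1 in the first claim and to
  \<open>norm e\<close> in the second, because adding epsilon times \<open>e\<close> makes all
  eigenvalues nonnegative.\<close>

text \<open>Near the origin the polytope \<open>convex hull (insert 0 A)\<close> coincides with the cone, because among its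
  finitely many inequalities those with positive right-hand side are inactive there.\<close>

lemma finite_cone_representation_bound:
  fixes A :: "'a::euclidean_space set"
  assumes "finite A"
  shows "\<exists>c\<ge>0. \<forall>v \<in> convex_cone hull A. \<exists>u. (\<forall>a\<in>A. 0 \<le> u a) \<and>
           v = (\<Sum>a\<in>A. u a *\<^sub>R a) \<and> sum u A \<le> c * norm v"
proof -
  define T where "T = convex hull (insert 0 A)"
  have "polyhedron T"
    unfolding T_def by (simp add: assms polyhedron_convex_hull)
  then obtain F where F: "finite F" "T = \<Inter>F"
    and half: "\<And>h. h \<in> F \<Longrightarrow> \<exists>a b. a \<noteq> 0 \<and> h = {x. a \<bullet> x \<le> b}"
    unfolding polyhedron_def by metis
  have AT: "insert 0 A \<subseteq> T"
    unfolding T_def by (rule hull_subset)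
  have "\<forall>\<^sub>F v in nhds 0. v \<in> convex_cone hull A \<longrightarrow> v \<in> h" if "h \<in> F" for h
  proof -
    obtain a b where h: "h = {x. a \<bullet> x \<le> b}"
      using half \<open>h \<in> F\<close> by blast
    have sub: "insert 0 A \<subseteq> h"
      using AT F(2) \<open>h \<in> F\<close> by blast
    show ?thesis
    proof (cases "b = 0")
      case True
      then have "convex_cone hull A \<subseteq> h"
        using sub h convex_cone_halfspace_le by (metis hull_minimal insert_subset)
      then show ?thesis by (auto intro: always_eventually)
    next
      case False
      then have "b > 0" using sub h by auto
      then have "\<forall>\<^sub>F v in nhds 0. a \<bullet> v < b"
        using eventually_nhds_in_open[OF open_halfspace_lt[of a b], of 0] by simp
      then show ?thesis
        by (rule eventually_mono) (simp add: h)
    qed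
  qed
  then have "\<forall>\<^sub>F v in nhds 0. \<forall>h\<in>F. v \<in> convex_cone hull A \<longrightarrow> v \<in> h"
    using F(1) by (intro eventually_ball_finite) auto
  then obtain d where d: "d > 0"
    "\<And>v. norm v < d \<Longrightarrow> v \<in> convex_cone hull A \<Longrightarrow> v \<in> T"
    unfolding eventually_nhds_metric F(2) by (auto simp: dist_norm)
  show ?thesis
  proof (intro exI[of _ "2/d"] conjI ballI)
    show "0 \<le> 2/d" using d(1) by simp
  next
    fix v assume v: "v \<in> convex_cone hull A"
    show "\<exists>u. (\<forall>a\<in>A. 0 \<le> u a) \<and> v = (\<Sum>a\<in>A. u a *\<^sub>R a) \<and> sum u A \<le> 2/d * norm v"
    proof (cases "v = 0")
      case True
      then show ?thesis by (intro exI[of _ "\<lambda>_. 0"]) simp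
    next
      case False
      \<comment> \<open>At norm d/2 the vector lies in \<open>T\<close>, where the weights on
        \<open>A\<close> add up to at most 1; undoing the scaling divides them by \<open>s\<close>,
        which produces the factor 2/d.\<close>
      define s where "s = d / (2 * norm v)"
      have s: "s > 0" using False d(1) by (simp add: s_def)
      have "s *\<^sub>R v \<in> T"
        using d False v by (intro d(2)) (auto simp: s_def intro!: convex_cone_hull_mul)
      then obtain u where u: "\<forall>a\<in>insert 0 A. 0 \<le> u a" "sum u (insert 0 A) = 1"
        "(\<Sum>a\<in>insert 0 A. u a *\<^sub>R a) = s *\<^sub>R v"
        unfolding T_def convex_hull_finite[OF finite.insertI[OF assms]] by blast
      have "(\<Sum>a\<in>A. u a *\<^sub>R a) = s *\<^sub>R v"
        using u(3) by (cases "0 \<in> A") (simp_all add: insert_absorb assms)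
      then have v_eq: "v = (\<Sum>a\<in>A. (u a / s) *\<^sub>R a)"
      proof -
        have "(\<Sum>a\<in>A. (u a / s) *\<^sub>R a) = (1 / s) *\<^sub>R (\<Sum>a\<in>A. u a *\<^sub>R a)"
          by (simp add: scaleR_sum_right)
        then show ?thesis using \<open>(\<Sum>a\<in>A. u a *\<^sub>R a) = s *\<^sub>R v\<close> s by simp
      qed
      have "sum u A \<le> 1"
        using u(1,2) assms sum_mono2[of "insert 0 A" A u] by auto
      then have "sum (\<lambda>a. u a / s) A \<le> 1 / s"
        using s by (simp add: divide_right_mono flip: sum_divide_distrib)
      also have "1 / s = 2/d * norm v"
        by (simp add: s_def)
      finally have le: "sum (\<lambda>a. u a / s) A \<le> 2/d * norm v" .
      show ?thesis
        using v_eq le u(1) s by (intro exI[of _ "\<lambda>a. u a / s"]) auto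
    qed
  qed
qed

text \<open>Farkas by separation: if \<open>w\<close> were outside the cone of active normals, some
  \<open>d\<close> would be nonnegative on that cone and negative on \<open>w\<close>. A short move
  along \<open>- d\<close> stays in \<open>S\<close>, since active constraints do not increase and
  the others have slack, yet it increases the product with \<open>w\<close>.\<close>

lemma normal_cone_finite_inequalities:
  fixes I :: "('a::euclidean_space \<times> real) set"
  assumes "finite I"
  defines "S \<equiv> {x. \<forall>(a,b)\<in>I. a \<bullet> x \<le> b}"
  assumes y: "y \<in> S" and opt: "\<And>z. z \<in> S \<Longrightarrow> w \<bullet> (z - y) \<le> 0"
  shows "w \<in> convex_cone hull {a. \<exists>b. (a,b) \<in> I \<and> a \<bullet> y = b}" (is "w \<in> convex_cone hull ?J")
proof (rule ccontr)
  assume notin: "w \<notin> convex_cone hull ?J"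
  have "?J \<subseteq> fst ` I" by force
  then have "finite ?J" using assms(1) finite_surj by blast
  then have "closed (convex_cone hull ?J)" by (rule closed_convex_cone_hull)
  then obtain d \<beta> where d: "d \<bullet> w < \<beta>" "\<forall>x\<in>convex_cone hull ?J. d \<bullet> x > \<beta>"
    using separating_hyperplane_closed_point[OF convex_convex_cone_hull _ notin] by blast
  have "\<beta> < 0"
    using d(2) convex_cone_hull_contains_0[of ?J] by auto
  \<comment> \<open>A negative value could be rescaled to exactly \<open>\<beta>\<close>, which the
    strict separation forbids.\<close>
  have nonneg: "d \<bullet> x \<ge> 0" if "x \<in> convex_cone hull ?J" for x
  proof (rule ccontr)
    assume neg: "\<not> 0 \<le> d \<bullet> x"
    then have "(\<beta> / (d \<bullet> x)) *\<^sub>R x \<in> convex_cone hull ?J"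
      using that \<open>\<beta> < 0\<close> by (intro convex_cone_hull_mul) (auto simp: zero_le_divide_iff)
    then show False using d(2) neg by fastforce
  qed
  have "\<forall>\<^sub>F t in at_right 0. a \<bullet> (y - t *\<^sub>R d) \<le> b" if ab: "(a,b) \<in> I" for a b
  proof (cases "a \<bullet> y = b")
    case True
    then have "a \<in> convex_cone hull ?J" using ab by (auto intro!: hull_inc)
    then have "a \<bullet> d \<ge> 0" using nonneg by (metis inner_commute)
    then show ?thesis
      using True by (auto simp: inner_diff_right
          intro!: eventually_mono[OF eventually_at_right_less[of 0]])
  next
    case False
    then have "a \<bullet> y < b" using y ab by (fastforce simp: S_def)
    moreover have "((\<lambda>t. a \<bullet> (y - t *\<^sub>R d)) \<longlongrightarrow> a \<bullet> (y - 0 *\<^sub>R d)) (at_right 0)"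
      by (intro tendsto_intros)
    ultimately have "\<forall>\<^sub>F t in at_right 0. a \<bullet> (y - t *\<^sub>R d) < b"
      using order_tendstoD(2) by force
    then show ?thesis by (rule eventually_mono) simp
  qed
  then have "\<forall>\<^sub>F t in at_right 0. \<forall>p\<in>I. fst p \<bullet> (y - t *\<^sub>R d) \<le> snd p"
    using assms(1) by (intro eventually_ball_finite) auto
  then have "\<forall>\<^sub>F t in at_right (0::real). y - t *\<^sub>R d \<in> S \<and> t > 0"
    by (rule eventually_elim2[OF _ eventually_at_right_less[of 0]]) (auto simp: S_def)
  then obtain t :: real where t: "y - t *\<^sub>R d \<in> S" "t > 0"
    using eventually_happens'[OF trivial_limit_at_right_real] by blast
  have "w \<bullet> d \<ge> 0"
    using opt[OF t(1)] t(2) by (simp add: zero_le_mult_iff)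
  then show False using d(1) \<open>\<beta> < 0\<close> by (simp add: inner_commute)
qed

lemma infdist_le_imp_point:
  fixes x :: "'a::euclidean_space"
  assumes "closed S" "S \<noteq> {}" "infdist x S \<le> \<eta>"
  obtains y where "y \<in> S" "norm (x - y) \<le> \<eta>"
  proof -
  obtain y where "y \<in> S" "infdist x S = dist x y"
    using infdist_attains_inf[OF assms(1,2), of x] by blast
  then show ?thesis using that assms(3) by (simp add: dist_norm)
qed

text \<open>At the projection \<open>y\<close> of \<open>x\<close>, the residual
  \<open>x - y\<close> is a nonnegative combination of active normals, each of which has product at
  most \<open>\<eta>\<close> with it. Pairing the residual with itself bounds its square by the sum
  of the weights times \<open>\<eta>\<close>, and that sum is linear in \<open>norm (x - y)\<close>.
  The constant is independent of \<open>x\<close> because only finitely many active sets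
  \<open>J\<close> are possible.\<close>

lemma hoffman_inequalities:
  fixes I :: "('a::euclidean_space \<times> real) set"
  assumes "finite I"
  defines "S \<equiv> {x. \<forall>(a,b)\<in>I. a \<bullet> x \<le> b}"
  assumes "S \<noteq> {}"
  shows "\<exists>c\<ge>0. \<forall>x \<eta>. 0 \<le> \<eta> \<and> (\<forall>(a,b)\<in>I. a \<bullet> x \<le> b + \<eta>) \<longrightarrow> infdist x S \<le> c * \<eta>"
proof -
  have "\<forall>J\<in>Pow (fst ` I). \<exists>c. c \<ge> 0 \<and> (\<forall>v \<in> convex_cone hull J. \<exists>u. (\<forall>a\<in>J. 0 \<le> u a) \<and>
           v = (\<Sum>a\<in>J. u a *\<^sub>R a) \<and> sum u J \<le> c * norm v)"
  proof
    fix J assume "J \<in> Pow (fst ` I)"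
    then have "finite J" using assms(1) by (meson PowD finite_imageI finite_subset)
    then show "\<exists>c. c \<ge> 0 \<and> (\<forall>v \<in> convex_cone hull J. \<exists>u. (\<forall>a\<in>J. 0 \<le> u a) \<and>
           v = (\<Sum>a\<in>J. u a *\<^sub>R a) \<and> sum u J \<le> c * norm v)"
      by (rule finite_cone_representation_bound)
  qed
  from bchoice[OF this] obtain C where C0: "\<forall>J\<in>Pow (fst ` I). C J \<ge> 0 \<and>
      (\<forall>v \<in> convex_cone hull J. \<exists>u. (\<forall>a\<in>J. 0 \<le> u a) \<and>
           v = (\<Sum>a\<in>J. u a *\<^sub>R a) \<and> sum u J \<le> C J * norm v)" ..
  have C: "\<And>J. J \<subseteq> fst ` I \<Longrightarrow> C J \<ge> 0"
    "\<And>J v. J \<subseteq> fst ` I \<Longrightarrow> v \<in> convex_cone hull J \<Longrightarrow>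
       \<exists>u. (\<forall>a\<in>J. 0 \<le> u a) \<and> v = (\<Sum>a\<in>J. u a *\<^sub>R a) \<and> sum u J \<le> C J * norm v"
    using bspec[OF C0] by (simp_all only: Pow_iff)
  define c where "c = sum C (Pow (fst ` I))"
  have C_le: "C J \<le> c" if "J \<subseteq> fst ` I" for J
    unfolding c_def using that C(1) assms(1) by (intro member_le_sum) auto
  have S_eq: "S = (\<Inter>p\<in>I. {x. fst p \<bullet> x \<le> snd p})"
    by (simp add: S_def set_eq_iff case_prod_beta)
  have S: "closed S" "convex S"
    unfolding S_eq by (auto intro!: closed_INT convex_INT closed_halfspace_le convex_halfspace_le)
  show ?thesis
  proof (intro exI[of _ c] conjI allI impI)
    show "c \<ge> 0" unfolding c_def by (intro sum_nonneg) (auto intro: C(1))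
  next
    fix x \<eta> assume asm: "0 \<le> \<eta> \<and> (\<forall>(a,b)\<in>I. a \<bullet> x \<le> b + \<eta>)"
    define y where "y = closest_point S x"
    define J where "J = {a. \<exists>b. (a,b) \<in> I \<and> a \<bullet> y = b}"
    have y: "y \<in> S" unfolding y_def using S assms(3) by (simp add: closest_point_in_set)
    have J: "J \<subseteq> fst ` I" unfolding J_def by force
    have "x - y \<in> convex_cone hull J"
      unfolding J_def
      using normal_cone_finite_inequalities[OF assms(1), of y "x - y"] y
        closest_point_dot[OF S(2,1)] unfolding S_def y_def by blast
    then obtain u where u: "\<forall>a\<in>J. 0 \<le> u a" "x - y = (\<Sum>a\<in>J. u a *\<^sub>R a)" "sum u J \<le> C J * norm (x - y)"
      using C(2)[OF J] by blast
    have le: "a \<bullet> (x - y) \<le> \<eta>" if "a \<in> J" for a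
      using that asm by (force simp: J_def inner_diff_right)
    have "norm (x - y) * norm (x - y) = (\<Sum>a\<in>J. u a *\<^sub>R a) \<bullet> (x - y)"
      using u(2) by (metis power2_eq_square power2_norm_eq_inner)
    also have "\<dots> = (\<Sum>a\<in>J. u a * (a \<bullet> (x - y)))"
      by (simp add: inner_sum_left)
    also have "\<dots> \<le> (\<Sum>a\<in>J. u a * \<eta>)"
      using u(1) le by (intro sum_mono mult_left_mono) auto
    also have "\<dots> = sum u J * \<eta>" by (simp add: sum_distrib_right)
    also have "\<dots> \<le> (C J * norm (x - y)) * \<eta>"
      using u(3) asm by (intro mult_right_mono) auto
    also have "\<dots> \<le> (c * norm (x - y)) * \<eta>"
      using C_le[OF J] asm by (intro mult_right_mono) auto
    finally have "norm (x - y) * norm (x - y) \<le> norm (x - y) * (c * \<eta>)"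
      by (simp add: mult_ac)
    moreover have "0 \<le> c * \<eta>"
      using C_le[OF J] C(1)[OF J] asm by auto
    ultimately have "norm (x - y) \<le> c * \<eta>"
      by (cases "norm (x - y) = 0") auto
    then show "infdist x S \<le> c * \<eta>"
      using infdist_le2[OF y] by (simp add: dist_norm)
  qed
qed

lemma polyhedron_inequalities:
  assumes "polyhedron (S :: 'a::euclidean_space set)"
  obtains I where "finite I" "S = {x. \<forall>(a,b)\<in>I. a \<bullet> x \<le> b}"
proof -
  obtain F where F: "finite F" "S = \<Inter>F" and half: "\<forall>h\<in>F. \<exists>a b. a \<noteq> 0 \<and> h = {x. a \<bullet> x \<le> b}"
    using assms unfolding polyhedron_def by blast
  have "\<forall>h\<in>F. \<exists>p. h = {x. fst p \<bullet> x \<le> (snd p::real)}"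
  proof
    fix h assume "h \<in> F"
    then obtain a b where "h = {x. a \<bullet> x \<le> b}" using half by blast
    then show "\<exists>p. h = {x. fst p \<bullet> x \<le> snd p}" by (intro exI[of _ "(a, b)"]) simp
  qed
  from bchoice[OF this]
  obtain p where p: "\<forall>h\<in>F. h = {x. fst (p h) \<bullet> x \<le> (snd (p h)::real)}"
    ..
  have "x \<in> h \<longleftrightarrow> fst (p h) \<bullet> x \<le> snd (p h)" if "h \<in> F" for x h
    using bspec[OF p that] by blast
  then have "S = {x. \<forall>(a,b)\<in>p ` F. a \<bullet> x \<le> b}"
    unfolding F(2) by (simp add: set_eq_iff case_prod_beta)
  then show ?thesis using that F(1) by blast
qed

lemma polyhedron_linear_vimage:
  fixes f :: "'a::euclidean_space \<Rightarrow> 'a"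
  assumes "linear f" "polyhedron S"
  shows "polyhedron (f -` S)"
proof -
  obtain I where I: "finite I" "S = {x. \<forall>(a,b)\<in>I. a \<bullet> x \<le> b}"
    using polyhedron_inequalities[OF assms(2)] .
  have "f -` S = \<Inter>((\<lambda>(a,b). {x. adjoint f a \<bullet> x \<le> b}) ` I)"
    by (auto simp: I(2) adjoint_clauses(2)[OF assms(1)])
  moreover have "polyhedron \<dots>"
    using I(1) by (intro polyhedron_Inter) (auto simp: polyhedron_halfspace_le)
  ultimately show ?thesis by simp
qed

text \<open>A point within \<open>\<eta>\<close> of a polyhedron violates an inequality with normal
  \<open>a\<close> by at most \<open>norm a * \<eta>\<close>, so both distances turn into violations
  of the joint system, at most \<open>M * \<eta>\<close> each.\<close>

lemma hoffman_polyhedra: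
  fixes P Q :: "'a::euclidean_space set"
  assumes "polyhedron P" "polyhedron Q" "P \<inter> Q \<noteq> {}"
  shows "\<exists>c\<ge>0. \<forall>x \<eta>. infdist x P \<le> \<eta> \<and> infdist x Q \<le> \<eta> \<longrightarrow> infdist x (P \<inter> Q) \<le> c * \<eta>"
proof -
  obtain I where I: "finite I" "P = {x. \<forall>(a,b)\<in>I. a \<bullet> x \<le> b}"
    using polyhedron_inequalities[OF assms(1)] .
  obtain J where J: "finite J" "Q = {x. \<forall>(a,b)\<in>J. a \<bullet> x \<le> b}"
    using polyhedron_inequalities[OF assms(2)] .
  have PQ: "P \<inter> Q = {x. \<forall>(a,b)\<in>I \<union> J. a \<bullet> x \<le> b}"
    by (auto simp: I(2) J(2))
  obtain c where c: "c \<ge> 0"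
    "\<And>x \<eta>. 0 \<le> \<eta> \<Longrightarrow> (\<forall>(a,b)\<in>I \<union> J. a \<bullet> x \<le> b + \<eta>) \<Longrightarrow> infdist x (P \<inter> Q) \<le> c * \<eta>"
    using hoffman_inequalities[of "I \<union> J"] I(1) J(1) assms(3) unfolding PQ by auto
  define M where "M = (\<Sum>p\<in>I \<union> J. norm (fst p))"
  have M: "norm a \<le> M" if "(a,b) \<in> I \<union> J" for a and b :: real
    unfolding M_def using member_le_sum[of "(a,b)" "I \<union> J" "\<lambda>p. norm (fst p)"] that I(1) J(1) by auto
  have M0: "M \<ge> 0" unfolding M_def by (intro sum_nonneg) auto
  have viol: "a \<bullet> x \<le> b + M * \<eta>"
    if R: "closed R" "R \<noteq> {}" "infdist x R \<le> \<eta>" "\<And>z. z \<in> R \<Longrightarrow> a \<bullet> z \<le> b" "norm a \<le> M"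
    for a x b \<eta> and R :: "'a set"
  proof -
    obtain z where z: "z \<in> R" "norm (x - z) \<le> \<eta>"
      using infdist_le_imp_point[OF R(1-3)] .
    have "a \<bullet> (x - z) \<le> norm a * norm (x - z)"
      by (rule norm_cauchy_schwarz)
    also have "\<dots> \<le> M * \<eta>" using that(5) z(2) M0 by (intro mult_mono) auto
    finally show ?thesis using that(4)[OF z(1)] by (simp add: inner_diff_right)
  qed
  have closed: "closed P" "closed Q" using assms polyhedron_imp_closed by auto
  have "infdist x (P \<inter> Q) \<le> (c * M) * \<eta>" if le: "infdist x P \<le> \<eta>" "infdist x Q \<le> \<eta>" for x \<eta>
  proof -
    have "\<eta> \<ge> 0" using le(1) infdist_nonneg order_trans by blast
    moreover have "a \<bullet> x \<le> b + M * \<eta>" if ab: "(a,b) \<in> I \<union> J" for a b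
      using ab
    proof
      assume "(a,b) \<in> I"
      then show ?thesis
        using M[OF ab] assms(3) le(1) by (intro viol[OF closed(1)]) (auto simp: I(2))
    next
      assume "(a,b) \<in> J"
      then show ?thesis
        using M[OF ab] assms(3) le(2) by (intro viol[OF closed(2)]) (auto simp: J(2))
    qed
    ultimately have "infdist x (P \<inter> Q) \<le> c * (M * \<eta>)"
      using M0 by (intro c(2)) auto
    then show ?thesis by (simp add: mult_ac)
  qed
  then show ?thesis
    using c(1) M0 by (intro exI[of _ "c * M"]) auto
qed

text \<open>Orthogonality makes the sum direct, since \<open>u - u' = v' - v\<close> is orthogonal
  to itself. With these maps, membership in a product cone becomes one condition on
  \<open>p1 x\<close> and one on \<open>p2 x\<close>.\<close>

lemma orthogonal_projections:
  fixes E1 E2 :: "'a::euclidean_space set"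
  assumes "subspace E1" "subspace E2" and orth: "\<forall>u\<in>E1. \<forall>v\<in>E2. orthogonal u v"
    and sum: "{u + v |u v. u \<in> E1 \<and> v \<in> E2} = UNIV"
  obtains p1 p2 where "linear p1" "linear p2" "\<And>u v. u \<in> E1 \<Longrightarrow> v \<in> E2 \<Longrightarrow> p1 (u + v) = u \<and> p2 (u + v) = v"
    "\<And>x. p1 x \<in> E1" "\<And>x. p2 x \<in> E2" "\<And>x. p1 x + p2 x = x" "\<And>x. norm (p1 x) \<le> norm x"
proof -
  have "\<forall>x. \<exists>p. fst p \<in> E1 \<and> snd p \<in> E2 \<and> fst p + snd p = x"
  proof
    fix x :: 'a
    have "x \<in> {u + v |u v. u \<in> E1 \<and> v \<in> E2}" using sum by simp
    then show "\<exists>p. fst p \<in> E1 \<and> snd p \<in> E2 \<and> fst p + snd p = x" by force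
  qed
  then obtain p where p: "\<And>x. fst (p x) \<in> E1" "\<And>x. snd (p x) \<in> E2" "\<And>x. fst (p x) + snd (p x) = x"
    by metis
  have uniq: "u = u' \<and> v = v'" if "u \<in> E1" "u' \<in> E1" "v \<in> E2" "v' \<in> E2" "u + v = u' + v'" for u u' v v'
  proof -
    have eq: "u - u' = v' - v" using that(5) by (simp add: algebra_simps)
    have "(u - u') \<bullet> (v' - v) = 0"
      using orth that assms(1,2) by (metis subspace_diff orthogonal_def)
    then have "v' - v = 0" using eq by simp
    then show ?thesis using eq by simp
  qed
  have split: "fst (p (u + v)) = u \<and> snd (p (u + v)) = v" if "u \<in> E1" "v \<in> E2" for u v
    using uniq[of "fst (p (u + v))" u "snd (p (u + v))" v] that p by auto
  have add: "fst (p (x + y)) = fst (p x) + fst (p y) \<and> snd (p (x + y)) = snd (p x) + snd (p y)" for x y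
  proof -
    have "x + y = (fst (p x) + fst (p y)) + (snd (p x) + snd (p y))"
      using p(3)[of x] p(3)[of y] by (metis add.assoc add.left_commute)
    then show ?thesis
      using split[of "fst (p x) + fst (p y)" "snd (p x) + snd (p y)"] p assms(1,2)
      by (simp add: subspace_add)
  qed
  have scale: "fst (p (r *\<^sub>R x)) = r *\<^sub>R fst (p x) \<and> snd (p (r *\<^sub>R x)) = r *\<^sub>R snd (p x)" for r x
  proof -
    have "r *\<^sub>R x = r *\<^sub>R fst (p x) + r *\<^sub>R snd (p x)"
      using p(3)[of x] by (metis scaleR_right_distrib)
    then show ?thesis
      using split[of "r *\<^sub>R fst (p x)" "r *\<^sub>R snd (p x)"] p assms(1,2)
      by (simp add: subspace_mul)
  qed
  have "norm (fst (p x)) \<le> norm x" for x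
  proof -
    have "norm (fst (p x)) ^ 2 \<le> norm (fst (p x)) ^ 2 + norm (snd (p x)) ^ 2" by simp
    also have "\<dots> = norm x ^ 2"
      using norm_add_Pythagorean[of "fst (p x)" "snd (p x)"] orth p by metis
    finally show ?thesis by (simp add: power2_le_iff_abs_le)
  qed
  then show ?thesis
    using that[of "\<lambda>x. fst (p x)" "\<lambda>x. snd (p x)"] add scale split p by (simp add: linear_iff)
qed

section \<open>Bounded linear regularity under the PPS condition\<close>

lemma affine_translate: "subspace L \<Longrightarrow> affine (translate L a)"
  unfolding translate_def
  using affine_translation[of L a] by (simp add: add.commute[of _ a] subspace_imp_affine)

lemma closed_translate: "subspace L \<Longrightarrow> closed (translate (L::'a::euclidean_space set) a)"
  by (simp add: affine_translate affine_closed)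

text \<open>Enlarging \<open>C1\<close> to its span turns \<open>C\<close> into a polyhedron, and
  Hoffman's bound gives a nearby point \<open>q\<close> of the affine space whose only defect is
  that \<open>p1 q\<close> may miss \<open>C1\<close>. Moving \<open>q\<close> slightly towards the
  Slater point \<open>x1 + x2\<close> repairs this: a ball around \<open>x1\<close> within the span
  of \<open>C1\<close> absorbs the defect, while the affine space and \<open>C2\<close> are
  preserved by convexity.\<close>

lemma PPS_bounded_linear_regularity:
  fixes C L :: "'a::euclidean_space set"
  assumes "PPS C L a" "subspace L"
  shows "\<exists>\<kappa>\<ge>0. \<forall>x \<epsilon>. 0 < \<epsilon> \<and> \<epsilon> \<le> \<beta> \<and> infdist x C \<le> \<epsilon> \<and> infdist x (translate L a) \<le> \<epsilon> \<and> norm x \<le> \<rho> \<longrightarrow>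
           infdist x (translate L a \<inter> C) \<le> \<kappa> * \<epsilon>"
proof -
  obtain E1 E2 C1 C2 x1 x2 where E: "subspace E1" "subspace E2" "\<forall>u\<in>E1. \<forall>v\<in>E2. orthogonal u v"
      "{u + v |u v. u \<in> E1 \<and> v \<in> E2} = UNIV"
    and C1: "C1 \<subseteq> E1" "closed C1" "convex C1" "cone C1"
    and C2: "C2 \<subseteq> E2" "closed C2" "convex C2" "cone C2"
    and C: "C = {u + v |u v. u \<in> C1 \<and> v \<in> C2}" and "polyhedron C2"
    and x12: "x1 + x2 \<in> translate L a" "x1 \<in> rel_interior C1" "x2 \<in> C2"
    using assms(1) unfolding PPS_def by blast
  obtain p1 p2 where p: "linear p1" "linear p2" "\<And>u v. u \<in> E1 \<Longrightarrow> v \<in> E2 \<Longrightarrow> p1 (u + v) = u \<and> p2 (u + v) = v"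
    "\<And>x. p1 x \<in> E1" "\<And>x. p2 x \<in> E2" "\<And>x. p1 x + p2 x = x" "\<And>x. norm (p1 x) \<le> norm x"
    using orthogonal_projections[OF E] by blast
  have x1C: "x1 \<in> C1" using x12(2) rel_interior_subset by blast
  have "0 \<in> C1" using x1C C1(4) cone_def by fastforce
  then have aff: "affine hull C1 = span C1"
    by (simp add: affine_hull_span_0 hull_inc)
  obtain \<delta> where \<delta>: "\<delta> > 0" "cball x1 \<delta> \<inter> span C1 \<subseteq> C1"
    using x12(2) unfolding mem_rel_interior_cball aff by blast
  have C_iff: "x \<in> C \<longleftrightarrow> p1 x \<in> C1 \<and> p2 x \<in> C2" for x
    unfolding C using p C1(1) C2(1) by (smt (verit) mem_Collect_eq subsetD)
  \<comment> \<open>The polyhedral relaxation of \<open>C\<close>: the first factor is replaced by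
    its span, the second is kept.\<close>
  define P where "P = p1 -` span C1 \<inter> p2 -` C2"
  have "polyhedron (span C1)"
    by (metis aff polyhedron_affine_hull)
  then have "polyhedron P"
    unfolding P_def using p(1,2) \<open>polyhedron C2\<close> by (intro polyhedron_Int polyhedron_linear_vimage)
  have CP: "C \<subseteq> P"
    unfolding P_def using C_iff span_superset by blast
  have "affine (translate L a)" by (rule affine_translate[OF assms(2)])
  then have "polyhedron (translate L a)"
    by (metis hull_same polyhedron_affine_hull)
  have xC: "x1 + x2 \<in> C" unfolding C using x1C x12(3) by blast
  have conv: "convex (translate L a)"
    by (simp add: \<open>affine (translate L a)\<close> affine_imp_convex)
  have closedC: "closed C"
  proof -
    have "C = p1 -` C1 \<inter> p2 -` C2" using C_iff by auto
    then show ?thesis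
      using p(1,2) C1(2) C2(2) by (auto intro!: closed_Int closed_vimage linear_continuous_on simp: linear_linear linear_continuous_on)
  qed
  obtain c where c: "c \<ge> 0" "\<And>x \<eta>. infdist x (translate L a) \<le> \<eta> \<Longrightarrow> infdist x P \<le> \<eta> \<Longrightarrow>
      infdist x (translate L a \<inter> P) \<le> c * \<eta>"
    using hoffman_polyhedra[OF \<open>polyhedron (translate L a)\<close> \<open>polyhedron P\<close>] xC CP x12(1) by blast
  \<comment> \<open>The first summand is the Hoffman step from \<open>x\<close> to \<open>q\<close>.
    The second is the move towards \<open>x1 + x2\<close>: its relative length is at most
    \<open>(1 + c) * \<epsilon> / \<delta>\<close>, and the other factor bounds the distance from
    \<open>q\<close> to that point.\<close>
  define \<kappa> where "\<kappa> = c + (1 + c) * (norm (x1 + x2) + (\<bar>\<rho>\<bar> + c * \<bar>\<beta>\<bar>)) / \<delta>"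
  have "infdist x (translate L a \<inter> C) \<le> \<kappa> * \<epsilon>"
    if asm: "0 < \<epsilon>" "\<epsilon> \<le> \<beta>" "infdist x C \<le> \<epsilon>" "infdist x (translate L a) \<le> \<epsilon>" "norm x \<le> \<rho>" for x \<epsilon>
  proof -
    have "infdist x P \<le> \<epsilon>"
      using infdist_mono[OF CP, of x] xC asm(3) by (metis empty_iff order_trans)
    then have "infdist x (translate L a \<inter> P) \<le> c * \<epsilon>" using c(2) asm(4) by blast
    moreover have "closed (translate L a \<inter> P)"
      using \<open>polyhedron P\<close> \<open>polyhedron (translate L a)\<close> polyhedron_imp_closed by blast
    ultimately obtain q where q: "q \<in> translate L a" "q \<in> P" "norm (x - q) \<le> c * \<epsilon>"
      using xC CP x12(1) infdist_le_imp_point[of "translate L a \<inter> P" x "c * \<epsilon>"] by blast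
    define \<eta> where "\<eta> = (1 + c) * \<epsilon>"
    have \<eta>: "\<eta> > 0" using asm(1) c(1) by (simp add: \<eta>_def)
    obtain d0 where d0: "d0 \<in> C" "norm (x - d0) \<le> \<epsilon>"
      using infdist_le_imp_point[OF closedC _ asm(3)] xC by blast
    have "norm (q - d0) \<le> norm (x - d0) + norm (x - q)"
      by (metis dist_norm dist_triangle2 add.commute norm_minus_commute)
    then have qd: "norm (q - d0) \<le> \<eta>" using d0 q(3) by (simp add: \<eta>_def algebra_simps)
    \<comment> \<open>The weight for which the defect, of size at most \<open>\<eta>\<close>, has
      size at most \<open>\<delta>\<close> once scaled by \<open>(1 - t) / t\<close>.\<close>
    define t where "t = \<eta> / (\<eta> + \<delta>)"
    have t: "0 < t" "t < 1" "(1 - t) / t * \<eta> = \<delta>" "t \<le> \<eta> / \<delta>"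
    proof -
      have t1: "1 - t = \<delta> / (\<eta> + \<delta>)" using \<eta> \<delta>(1) by (simp add: t_def field_simps)
      show "0 < t" "t < 1" "t \<le> \<eta> / \<delta>" using \<eta> \<delta>(1) by (auto simp: t_def field_simps)
      show "(1 - t) / t * \<eta> = \<delta>" unfolding t1 using \<eta> \<delta>(1) by (simp add: t_def)
    qed
    define y where "y = t *\<^sub>R (x1 + x2) + (1 - t) *\<^sub>R q"
    have yL: "y \<in> translate L a"
      unfolding y_def using conv x12(1) q(1) t by (intro convexD) auto
    have px: "p1 (x1 + x2) = x1" "p2 (x1 + x2) = x2"
      using p(3)[of x1 x2] x1C x12(3) C1(1) C2(1) by auto
    have lin: "p1 y = t *\<^sub>R x1 + (1 - t) *\<^sub>R p1 q" "p2 y = t *\<^sub>R x2 + (1 - t) *\<^sub>R p2 q"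
      unfolding y_def using px by (simp_all add: linear_add[OF p(1)] linear_add[OF p(2)]
          linear_scale[OF p(1)] linear_scale[OF p(2)])
    have "p2 y \<in> C2"
      unfolding lin using q(2) x12(3) t C2(3) by (intro convexD) (auto simp: P_def)
    moreover have "p1 y \<in> C1"
    proof -
      \<comment> \<open>The combination of \<open>x1\<close> and \<open>p1 q\<close> is regrouped as
        one of \<open>w\<close> and \<open>p1 d0\<close>: the defect \<open>p1 q - p1 d0\<close> is
        loaded onto \<open>x1\<close>, whose ball has room for it.\<close>
      define w where "w = x1 + ((1 - t) / t) *\<^sub>R (p1 q - p1 d0)"
      have d1: "p1 d0 \<in> C1" using d0 C_iff by blast
      have "norm (p1 q - p1 d0) \<le> \<eta>"
        using p(7)[of "q - d0"] qd by (simp add: linear_diff[OF p(1)])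
      then have "(1 - t) / t * norm (p1 q - p1 d0) \<le> (1 - t) / t * \<eta>"
        using t(1,2) by (intro mult_left_mono) auto
      then have "norm (w - x1) \<le> \<delta>"
        using t by (simp add: w_def)
      moreover have "w \<in> span C1"
        unfolding w_def using x1C d1 q(2)
        by (intro span_add span_scale span_diff) (auto simp: P_def intro: span_base)
      ultimately have "w \<in> C1" using \<delta>(2) by (auto simp: dist_norm norm_minus_commute)
      then have "t *\<^sub>R w + (1 - t) *\<^sub>R p1 d0 \<in> C1"
        using d1 t C1(3) by (intro convexD) auto
      also have "t *\<^sub>R w + (1 - t) *\<^sub>R p1 d0 = p1 y"
      proof -
        have "t *\<^sub>R w = t *\<^sub>R x1 + (1 - t) *\<^sub>R (p1 q - p1 d0)"
          unfolding w_def using t(1) by (simp add: scaleR_right_distrib)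
        then show ?thesis unfolding lin by (simp add: algebra_simps)
      qed
      finally show ?thesis .
    qed
    ultimately have "y \<in> translate L a \<inter> C" using yL C_iff by blast
    then have "infdist x (translate L a \<inter> C) \<le> norm (x - y)"
      by (metis dist_norm infdist_le)
    also have "\<dots> \<le> norm (x - q) + norm (y - q)"
      by (metis dist_norm dist_triangle2)
    also have "y - q = t *\<^sub>R (x1 + x2 - q)" by (simp add: y_def algebra_simps)
    also have "norm (t *\<^sub>R (x1 + x2 - q)) \<le> (\<eta> / \<delta>) * (norm (x1 + x2) + (\<bar>\<rho>\<bar> + c * \<bar>\<beta>\<bar>))"
    proof -
      have "norm q \<le> norm x + norm (x - q)" by (metis add.commute norm_triangle_sub norm_minus_commute)
      also have "\<dots> \<le> \<rho> + c * \<epsilon>" using asm(5) q(3) by simp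
      also have "\<dots> \<le> \<bar>\<rho>\<bar> + c * \<bar>\<beta>\<bar>"
        using c(1) asm(2) by (intro add_mono mult_left_mono) auto
      finally have "norm (x1 + x2 - q) \<le> norm (x1 + x2) + (\<bar>\<rho>\<bar> + c * \<bar>\<beta>\<bar>)"
        using norm_triangle_ineq4[of "x1 + x2" q] by simp
      then show ?thesis using t \<eta> \<delta>(1) by (simp del: times_divide_eq_left) (intro mult_mono, auto)
    qed
    finally show ?thesis
      using q(3) by (simp add: \<kappa>_def \<eta>_def algebra_simps add_divide_distrib)
  qed
  moreover have "\<kappa> \<ge> 0"
    using c(1) \<delta>(1) by (simp add: \<kappa>_def)
  ultimately show ?thesis by blast
qed

section \<open>Positive semidefinite forms\<close>

text \<open>An isotropic vector of a semidefinite form lies in its radical: along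
  \<open>v + t *\<^sub>R y\<close> the form is affine in \<open>t\<close>, so a nonzero slope would
  make it negative somewhere.\<close>

lemma psd_form_kernel:
  fixes B :: "'a::real_vector \<Rightarrow> 'a \<Rightarrow> real"
  assumes "bilinear B" and sym: "\<And>u v. B u v = B v u" and "subspace V"
    and psd: "\<And>u. u \<in> V \<Longrightarrow> B u u \<ge> 0"
    and y: "y \<in> V" "B y y = 0" and v: "v \<in> V"
  shows "B y v = 0"
proof (rule ccontr)
  assume nz: "B y v \<noteq> 0"
  \<comment> \<open>Chosen so that the form takes the value -1.\<close>
  define t where "t = - (B v v + 1) / (2 * B y v)"
  have "v + t *\<^sub>R y \<in> V"
    using y(1) v \<open>subspace V\<close> by (simp add: subspace_add subspace_mul)
  then have "0 \<le> B (v + t *\<^sub>R y) (v + t *\<^sub>R y)" by (rule psd)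
  also have "\<dots> = B v v + 2 * t * B y v"
    using y(2) by (simp add: bilinear_ladd[OF assms(1)] bilinear_radd[OF assms(1)]
        bilinear_lmul[OF assms(1)] bilinear_rmul[OF assms(1)] sym[of v y])
  also have "2 * t * B y v = - (B v v + 1)" using nz by (simp add: t_def)
  finally show False by simp
qed

lemma psd_form_kernel_subspace:
  fixes B :: "'a::real_vector \<Rightarrow> 'a \<Rightarrow> real"
  assumes "bilinear B" and sym: "\<And>u v. B u v = B v u" and "subspace V"
    and psd: "\<And>u. u \<in> V \<Longrightarrow> B u u \<ge> 0"
  shows "subspace {y \<in> V. B y y = 0}"
  unfolding subspace_def
  using psd_form_kernel[OF assms] \<open>subspace V\<close>
  by (auto simp: subspace_0 subspace_add subspace_mul bilinear_lzero[OF assms(1)]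
      bilinear_ladd[OF assms(1)] bilinear_radd[OF assms(1)]
      bilinear_lmul[OF assms(1)] bilinear_rmul[OF assms(1)])

text \<open>The witness \<open>y0\<close> is the orthogonal projection of \<open>y\<close> onto the
  kernel \<open>N\<close>. The form is positive definite on the complement \<open>W\<close> of
  \<open>N\<close> in \<open>V\<close>, hence bounded below there by its minimum on the compact unit
  sphere; and \<open>y\<close> has the same form value as its component in \<open>W\<close>, because
  isotropic vectors lie in the radical.\<close>

lemma psd_form_growth:
  fixes B :: "'a::euclidean_space \<Rightarrow> 'a \<Rightarrow> real"
  assumes "bilinear B" and sym: "\<And>u v. B u v = B v u" and "subspace V"
    and psd: "\<And>u. u \<in> V \<Longrightarrow> B u u \<ge> 0"
  shows "\<exists>c\<ge>0. \<forall>y\<in>V. \<exists>y0\<in>V. B y0 y0 = 0 \<and> norm y0 \<le> norm y \<and> (norm (y - y0))\<^sup>2 \<le> c * B y y"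
proof -
  define N where "N = {y \<in> V. B y y = 0}"
  have N: "subspace N" unfolding N_def by (rule psd_form_kernel_subspace[OF assms])
  define W where "W = V \<inter> N\<^sup>\<bottom>"
  have W: "subspace W"
    unfolding W_def using \<open>subspace V\<close> subspace_orthogonal_comp by (rule subspace_inter)
  obtain c where c: "c \<ge> 0" "\<And>w. w \<in> W \<Longrightarrow> (norm w)\<^sup>2 \<le> c * B w w"
  proof (cases "W \<inter> sphere 0 1 = {}")
    case True
    have "w = 0" if "w \<in> W" for w
    proof (rule ccontr)
      assume "w \<noteq> 0"
      then have "(1 / norm w) *\<^sub>R w \<in> W \<inter> sphere 0 1"
        using W that by (auto simp: subspace_mul)
      then show False using True by blast
    qed
    then show ?thesis using that[of 0] by fastforce
  next
    case False
    have "bounded_bilinear B" using assms(1) by (simp add: bilinear_conv_bounded_bilinear)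
    then have "continuous_on (W \<inter> sphere 0 1) (\<lambda>w. B w w)"
      by (rule bounded_bilinear.continuous_on[OF _ continuous_on_id continuous_on_id])
    moreover have "compact (W \<inter> sphere 0 1)"
      by (rule closed_Int_compact[OF closed_subspace[OF W] compact_sphere])
    ultimately obtain w0 where "w0 \<in> W \<inter> sphere 0 1" "\<forall>w\<in>W \<inter> sphere 0 1. B w0 w0 \<le> B w w"
      using continuous_attains_inf[of "W \<inter> sphere 0 1" "\<lambda>w. B w w"] False by blast
    then have w0: "w0 \<in> W" "norm w0 = 1" "\<And>w. w \<in> W \<Longrightarrow> norm w = 1 \<Longrightarrow> B w0 w0 \<le> B w w"
      by auto
    have "w0 \<notin> N"
    proof
      assume "w0 \<in> N"
      then have "w0 \<bullet> w0 = 0"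
        using w0(1) by (auto simp: W_def orthogonal_comp_def orthogonal_def)
      then show False using w0(2) by simp
    qed
    then have pos: "B w0 w0 > 0"
      using psd[of w0] w0(1) by (force simp: W_def N_def)
    have "(norm w)\<^sup>2 \<le> (1 / B w0 w0) * B w w" if "w \<in> W" for w
    proof (cases "w = 0")
      case True
      then show ?thesis by (simp add: bilinear_lzero[OF assms(1)])
    next
      case False
      have "B w0 w0 \<le> B ((1 / norm w) *\<^sub>R w) ((1 / norm w) *\<^sub>R w)"
        using False that W by (intro w0(3)) (auto simp: subspace_mul)
      also have "\<dots> = B w w / (norm w)\<^sup>2"
        by (simp add: bilinear_lmul[OF assms(1)] bilinear_rmul[OF assms(1)] power2_eq_square)
      finally show ?thesis using False pos by (simp add: field_simps)
    qed
    then show ?thesis using that[of "1 / B w0 w0"] pos by auto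
  qed
  have "\<exists>y0\<in>V. B y0 y0 = 0 \<and> norm y0 \<le> norm y \<and> (norm (y - y0))\<^sup>2 \<le> c * B y y" if "y \<in> V" for y
  proof -
    obtain y0 w where yw: "y0 \<in> span N" "\<And>u. u \<in> span N \<Longrightarrow> orthogonal w u" "y = y0 + w"
      using orthogonal_subspace_decomp_exists[of N y] by blast
    have y0: "y0 \<in> N" using yw(1) N by (simp add: span_eq_iff[THEN iffD2])
    have "w = y - y0" using yw(3) by simp
    then have "w \<in> V" using y0 that \<open>subspace V\<close> by (simp add: N_def subspace_diff)
    then have wW: "w \<in> W"
      using yw(2) by (auto simp: W_def orthogonal_comp_def orthogonal_commute span_base)
    have "B y y = B w w"
      using y0 psd_form_kernel[OF assms, of y0 w] \<open>w \<in> V\<close>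
      unfolding yw(3) by (simp add: N_def bilinear_ladd[OF assms(1)] bilinear_radd[OF assms(1)] sym[of w y0])
    moreover have "norm y0 \<le> norm y"
    proof -
      have "(norm y)\<^sup>2 = (norm y0)\<^sup>2 + (norm w)\<^sup>2"
        unfolding yw(3) using yw(2)[OF yw(1)] by (intro norm_add_Pythagorean) (simp add: orthogonal_commute)
      then show ?thesis by (metis le_add_same_cancel1 norm_ge_zero power2_le_imp_le zero_le_power2)
    qed
    ultimately show ?thesis
      using y0 c(2)[OF wW] \<open>w = y - y0\<close> by (auto simp: N_def)
  qed
  then show ?thesis using c(1) by blast
qed

text \<open>A maximiser \<open>v\<close> of the Rayleigh quotient on \<open>W\<close>, with maximum
  \<open>\<mu>\<close>, is isotropic for the form of \<open>\<mu>\<close> minus \<open>T\<close>,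
  which is semidefinite on \<open>W\<close>. Hence \<open>\<mu> *\<^sub>R v - T v\<close> is
  orthogonal to \<open>W\<close>; lying in \<open>W\<close> itself, it is 0.\<close>

lemma symmetric_eigenvector:
  fixes T :: "'a::euclidean_space \<Rightarrow> 'a"
  assumes "linear T" and sym: "\<And>u v. T u \<bullet> v = u \<bullet> T v" and "subspace W"
    and inv: "\<And>u. u \<in> W \<Longrightarrow> T u \<in> W" and "w \<in> W" "w \<noteq> 0"
  obtains v \<mu> where "v \<in> W" "v \<noteq> 0" "T v = \<mu> *\<^sub>R v"
proof -
  have "(1 / norm w) *\<^sub>R w \<in> W \<inter> sphere 0 1"
    using assms(3,5,6) by (auto simp: subspace_mul)
  moreover have "compact (W \<inter> sphere 0 1)"
    by (rule closed_Int_compact[OF closed_subspace[OF \<open>subspace W\<close>] compact_sphere])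
  moreover have "continuous_on (W \<inter> sphere 0 1) (\<lambda>u. T u \<bullet> u)"
    using \<open>linear T\<close> by (intro continuous_intros linear_continuous_on) (simp add: linear_linear)
  ultimately obtain v where "v \<in> W \<inter> sphere 0 1" "\<forall>u\<in>W \<inter> sphere 0 1. T u \<bullet> u \<le> T v \<bullet> v"
    using continuous_attains_sup[of "W \<inter> sphere 0 1" "\<lambda>u. T u \<bullet> u"] by blast
  then have v: "v \<in> W" "norm v = 1" "\<And>u. u \<in> W \<Longrightarrow> norm u = 1 \<Longrightarrow> T u \<bullet> u \<le> T v \<bullet> v"
    by auto
  define \<mu> where "\<mu> = T v \<bullet> v"
  define B where "B = (\<lambda>x y. \<mu> * (x \<bullet> y) - T x \<bullet> y)"
  have "bilinear B"
    unfolding bilinear_def B_def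
    by (auto intro!: linearI simp: linear_add[OF \<open>linear T\<close>] linear_scale[OF \<open>linear T\<close>]
        inner_add_left inner_add_right algebra_simps)
  moreover have "B x y = B y x" for x y
    unfolding B_def using sym[of x y] by (simp add: inner_commute)
  moreover have "0 \<le> B u u" if "u \<in> W" for u
  proof (cases "u = 0")
    case True
    then show ?thesis by (simp add: B_def)
  next
    case False
    have "T ((1 / norm u) *\<^sub>R u) \<bullet> ((1 / norm u) *\<^sub>R u) \<le> \<mu>"
      unfolding \<mu>_def using False that \<open>subspace W\<close> by (intro v(3)) (auto simp: subspace_mul)
    then have "(T u \<bullet> u) / (norm u)\<^sup>2 \<le> \<mu>"
      by (simp add: linear_scale[OF \<open>linear T\<close>] power2_eq_square)
    then show ?thesis
      using False by (simp add: B_def field_simps flip: power2_norm_eq_inner)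
  qed
  moreover have "B v v = 0"
    using v(2) by (simp add: B_def \<mu>_def flip: power2_norm_eq_inner)
  ultimately have "B v u = 0" if "u \<in> W" for u
    using psd_form_kernel[of B W v u] that v(1) \<open>subspace W\<close> by blast
  moreover have "\<mu> *\<^sub>R v - T v \<in> W"
    using v(1) inv \<open>subspace W\<close> by (simp add: subspace_diff subspace_mul)
  ultimately have "(\<mu> *\<^sub>R v - T v) \<bullet> (\<mu> *\<^sub>R v - T v) = 0"
    unfolding B_def by (metis inner_diff_left inner_scaleR_left)
  then have "T v = \<mu> *\<^sub>R v" by simp
  moreover have "v \<noteq> 0" using v(2) by auto
  ultimately show ?thesis using that v(1) by blast
qed

section \<open>Termination of facial reduction\<close>

lemma mem_translate: "x \<in> translate L a \<longleftrightarrow> x - a \<in> L"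
  unfolding translate_def by (force simp: image_iff)

lemma exposing_vector_inner:
  assumes "z \<in> L\<^sup>\<bottom> \<inter> {a}\<^sup>\<bottom>" "x \<in> translate L a"
  shows "x \<bullet> z = 0"
proof -
  have "(x - a) \<bullet> z = 0" "a \<bullet> z = 0"
    using assms by (auto simp: mem_translate orthogonal_comp_def orthogonal_def)
  then show ?thesis by (simp add: inner_diff_left)
qed

text \<open>Let \<open>D\<close> be \<open>F\<close> minus the affine space. It contains 0, but not
  in its relative interior, which is the sum of the two relative interiors. A supporting hyperplane
  at 0 gives \<open>z\<close>, nonnegative on \<open>D\<close> and positive on its relative
  interior; the strict part supplies \<open>f\<close>, so that intersecting with the complement of
  \<open>z\<close> really shrinks the span of \<open>F\<close>.\<close>

lemma exposing_vector_exists: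
  fixes F L :: "'a::euclidean_space set"
  assumes "convex F" "cone F" "subspace L"
    and x: "x \<in> F" "x \<in> translate L a" and disj: "rel_interior F \<inter> translate L a = {}"
  obtains z f where "z \<in> dual_cone F \<inter> L\<^sup>\<bottom> \<inter> {a}\<^sup>\<bottom>" "f \<in> F" "f \<bullet> z \<noteq> 0"
proof -
  define D where "D = F + translate L (- a)"
  have neg: "- y \<in> translate L a \<longleftrightarrow> y \<in> translate L (- a)" for y
  proof -
    have "- y - a = - (y - - a)" by simp
    then show ?thesis
      unfolding mem_translate using subspace_neg[OF \<open>subspace L\<close>] by (metis minus_minus)
  qed
  have aff: "affine (translate L (- a))" by (rule affine_translate[OF \<open>subspace L\<close>])
  have "convex D"
    unfolding D_def using \<open>convex F\<close> aff affine_imp_convex by (intro convex_set_plus) auto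
  have ri: "rel_interior D = rel_interior F + translate L (- a)"
    unfolding D_def using rel_interior_sum[OF \<open>convex F\<close> affine_imp_convex[OF aff]]
    by (simp add: rel_interior_affine[OF aff])
  have "0 \<in> D"
    unfolding D_def using x neg[of "- x"] set_plus_intro[of x F "- x" "translate L (- a)"] by simp
  moreover have "0 \<notin> rel_interior D"
  proof
    assume "0 \<in> rel_interior D"
    then obtain f y where fy: "f \<in> rel_interior F" "y \<in> translate L (- a)" "f + y = 0"
      unfolding ri by (metis set_plus_elim)
    then have "f \<in> translate L a" using neg[of y] by (metis add_eq_0_iff2)
    then show False using fy(1) disj by blast
  qed
  ultimately obtain z where z: "\<And>y. y \<in> D \<Longrightarrow> z \<bullet> 0 \<le> z \<bullet> y" "\<And>y. y \<in> rel_interior D \<Longrightarrow> z \<bullet> 0 < z \<bullet> y"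
    using supporting_hyperplane_rel_boundary[OF \<open>convex D\<close>] by blast
  have ge: "z \<bullet> y \<le> z \<bullet> f" if "f \<in> F" "y \<in> translate L a" for f y
  proof -
    have "f + - y \<in> D" unfolding D_def using that neg[of "- y"] by (intro set_plus_intro) auto
    then show ?thesis using z(1) by (force simp: inner_diff_right)
  qed
  have zL: "z \<bullet> l = 0" if "l \<in> L" for l
  proof -
    have "x + r *\<^sub>R l \<in> translate L a" for r
      using x(2) that \<open>subspace L\<close> unfolding mem_translate
      by (metis add_diff_eq add.commute subspace_add subspace_mul)
    then have "r * (z \<bullet> l) \<le> 0" for r
      using ge[OF x(1)] by (force simp: inner_add_right)
    from this[of 1] this[of "-1"] show ?thesis by simp
  qed
  have "z \<bullet> (x - a) = 0" using zL x(2) by (simp add: mem_translate)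
  then have zxa: "z \<bullet> x = z \<bullet> a" by (simp add: inner_diff_right)
  \<comment> \<open>The multiples 0 and 2 of the feasible point give both signs, so \<open>z\<close>
    vanishes at \<open>x\<close>; after that, \<open>ge\<close> says that \<open>z\<close> is
    nonnegative on \<open>F\<close>.\<close>
  have "t *\<^sub>R x \<in> F" if "t \<ge> 0" for t using \<open>cone F\<close> x(1) that by (simp add: cone_def)
  then have "z \<bullet> x \<le> t * (z \<bullet> x)" if "t \<ge> 0" for t using ge[OF _ x(2), of "t *\<^sub>R x"] that by simp
  from this[of 0] this[of 2] have zx: "z \<bullet> x = 0" by simp
  then have "z \<in> dual_cone F"
    using ge[OF _ x(2)] by (simp add: dual_cone_def)
  moreover have "z \<in> L\<^sup>\<bottom>" "z \<in> {a}\<^sup>\<bottom>"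
    using zL zx zxa by (auto simp: orthogonal_comp_def orthogonal_def inner_commute)
  moreover have "\<exists>f\<in>F. f \<bullet> z \<noteq> 0"
  proof -
    obtain d where d: "d \<in> rel_interior D"
      using rel_interior_eq_empty[OF \<open>convex D\<close>] \<open>0 \<in> D\<close> by blast
    then obtain f y where fy: "f \<in> F" "y \<in> translate L (- a)" "d = f + y"
      unfolding ri using rel_interior_subset by (metis set_plus_elim subsetD)
    have "- y \<in> translate L a" using neg fy(2) by blast
    then have "z \<bullet> (- y - a) = 0" using zL by (simp add: mem_translate)
    then have "z \<bullet> y = 0" using zx zxa by (simp add: inner_diff_right)
    then have "f \<bullet> z \<noteq> 0"
      using z(2)[OF d] by (simp add: fy(3) inner_add_right inner_commute)
    then show ?thesis using fy(1) by blast
  qed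
  ultimately show ?thesis using that by blast
qed

lemma PPS_rel_interior:
  fixes F L :: "'a::euclidean_space set"
  assumes "convex F" "cone F" "closed F" "rel_interior F \<inter> translate L a \<noteq> {}"
  shows "PPS F L a"
proof -
  obtain x where x: "x \<in> rel_interior F" "x \<in> translate L a" using assms(4) by blast
  have "polyhedron {0::'a}"
    using polyhedron_affine_hull[of "{0::'a}"] by simp
  moreover have "\<exists>x1 x2. x1 + x2 \<in> translate L a \<and> x1 \<in> rel_interior F \<and> x2 \<in> {0::'a}"
    using x by (intro exI[of _ x] exI[of _ 0]) simp
  ultimately show ?thesis
    unfolding PPS_def using assms(1-3)
    by (intro exI[of _ UNIV] exI[of _ "{0}"] exI[of _ F] conjI)
      (auto simp: orthogonal_def cone_def subspace_def)
qed

text \<open>Chains grow at the front here, as an induction on the dimension of the starting face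
  requires. Indices begin at 1, hence the shift by one.\<close>

lemma facial_reduction_PPS_Suc:
  assumes "z \<in> dual_cone F \<inter> L\<^sup>\<bottom> \<inter> {a}\<^sup>\<bottom>" "facial_reduction_PPS (F \<inter> {z}\<^sup>\<bottom>) L a k"
  shows "facial_reduction_PPS F L a (Suc k)"
proof -
  obtain G w where G: "G 1 = F \<inter> {z}\<^sup>\<bottom>"
      "\<And>i. i \<in> {1..k} \<Longrightarrow> w i \<in> dual_cone (G i) \<inter> L\<^sup>\<bottom> \<inter> {a}\<^sup>\<bottom> \<and> G (i + 1) = G i \<inter> {w i}\<^sup>\<bottom>"
      "PPS (G (k + 1)) L a"
    using assms(2) unfolding facial_reduction_PPS_def by blast
  define H where "H i = (if i = 1 then F else G (i - 1))" for i :: nat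
  define y where "y i = (if i = 1 then z else w (i - 1))" for i :: nat
  have "y i \<in> dual_cone (H i) \<inter> L\<^sup>\<bottom> \<inter> {a}\<^sup>\<bottom> \<and> H (i + 1) = H i \<inter> {y i}\<^sup>\<bottom>" if i: "i \<in> {1..Suc k}" for i
  proof (cases "i = 1")
    case True
    then show ?thesis using assms(1) G(1) by (simp add: H_def y_def)
  next
    case False
    then obtain j where "i = Suc j" "j \<in> {1..k}" using i by (cases i) force+
    then show ?thesis using G(2)[of j] by (auto simp: H_def y_def)
  qed
  then show ?thesis
    unfolding facial_reduction_PPS_def using G(3)
    by (intro exI[of _ H] exI[of _ y]) (auto simp: H_def)
qed

lemma facial_reduction_PPS_exists:
  fixes F L :: "'a::euclidean_space set"
  assumes "convex F" "cone F" "closed F" "subspace L" "F \<inter> translate L a \<noteq> {}"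
  shows "\<exists>k. facial_reduction_PPS F L a k"
  using assms(1,2,3,5)
proof (induction "dim F" arbitrary: F rule: less_induct)
  case less
  show ?case
  proof (cases "rel_interior F \<inter> translate L a = {}")
    case False
    then have "PPS F L a" using less.prems by (intro PPS_rel_interior) auto
    then have "facial_reduction_PPS F L a 0"
      unfolding facial_reduction_PPS_def by (intro exI[of _ "\<lambda>_. F"]) auto
    then show ?thesis ..
  next
    case True
    obtain x where x: "x \<in> F" "x \<in> translate L a" using less.prems by blast
    obtain z f where z: "z \<in> dual_cone F \<inter> L\<^sup>\<bottom> \<inter> {a}\<^sup>\<bottom>" and f: "f \<in> F" "f \<bullet> z \<noteq> 0"
      using exposing_vector_exists[OF less.prems(1,2) \<open>subspace L\<close> x True] .
    have sub: "subspace ({z}\<^sup>\<bottom>)" by (rule subspace_orthogonal_comp)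
    have "span (F \<inter> {z}\<^sup>\<bottom>) \<subseteq> {z}\<^sup>\<bottom>" using sub by (intro span_minimal) auto
    moreover have "f \<notin> {z}\<^sup>\<bottom>"
      using f(2) by (auto simp: orthogonal_comp_def orthogonal_def inner_commute)
    moreover have "f \<in> span F" using f(1) by (rule span_base)
    moreover have "span (F \<inter> {z}\<^sup>\<bottom>) \<subseteq> span F" by (intro span_mono) auto
    ultimately have "dim (F \<inter> {z}\<^sup>\<bottom>) < dim F" by (intro dim_psubset) blast
    moreover have "convex (F \<inter> {z}\<^sup>\<bottom>)" using less.prems(1) sub by (simp add: convex_Int subspace_imp_convex)
    moreover have "cone (F \<inter> {z}\<^sup>\<bottom>)"
      using less.prems(2) sub unfolding cone_def by (auto simp: subspace_mul)
    moreover have "closed (F \<inter> {z}\<^sup>\<bottom>)"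
      using less.prems(3) sub closed_subspace by (intro closed_Int) auto
    moreover have "x \<in> {z}\<^sup>\<bottom>"
      using exposing_vector_inner[of z L a x] z x(2)
      by (auto simp: orthogonal_comp_def orthogonal_def inner_commute)
    ultimately have "\<exists>k. facial_reduction_PPS (F \<inter> {z}\<^sup>\<bottom>) L a k"
      using x by (intro less.hyps) auto
    then show ?thesis using facial_reduction_PPS_Suc[OF z] by blast
  qed
qed

section \<open>Spectral theory and self-duality of the cone of squares\<close>

context euclidean_jordan_algebra
begin

section \<open>Multiplication operators and idempotents\<close>

lemma bounded_bilinear_jp: "bounded_bilinear jp"
  using bilinear_jp by (simp add: bilinear_conv_bounded_bilinear)

lemmas jp_add_left = bounded_bilinear.add_left[OF bounded_bilinear_jp]
  and jp_add_right = bounded_bilinear.add_right[OF bounded_bilinear_jp]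
  and jp_diff_left = bounded_bilinear.diff_left[OF bounded_bilinear_jp]
  and jp_diff_right = bounded_bilinear.diff_right[OF bounded_bilinear_jp]
  and jp_minus_left = bounded_bilinear.minus_left[OF bounded_bilinear_jp]
  and jp_minus_right = bounded_bilinear.minus_right[OF bounded_bilinear_jp]
  and jp_scaleR_left = bounded_bilinear.scaleR_left[OF bounded_bilinear_jp]
  and jp_scaleR_right = bounded_bilinear.scaleR_right[OF bounded_bilinear_jp]
  and jp_zero_left = bounded_bilinear.zero_left[OF bounded_bilinear_jp]
  and jp_zero_right = bounded_bilinear.zero_right[OF bounded_bilinear_jp]
  and jp_sum_left = bounded_bilinear.sum_left[OF bounded_bilinear_jp]
  and jp_sum_right = bounded_bilinear.sum_right[OF bounded_bilinear_jp]

lemmas jp_distribs = jp_add_left jp_add_right jp_diff_left jp_diff_right jp_minus_left jp_minus_right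
  jp_scaleR_left jp_scaleR_right jp_zero_left jp_zero_right

lemma identity_right: "jp x e = x"
  using identity commute by metis

lemma linear_jp: "linear (jp x)"
  by (rule linearI) (simp_all add: jp_distribs)

lemma jp_symmetric: "jp x u \<bullet> v = u \<bullet> jp x v"
  using inner_assoc[of u x v] commute by metis

text \<open>The polarised Jordan identity \<open>2 [L(x), L(x u)] + [L(u), L(x x)] = 0\<close>, read as an
  identity of operators acting on \<open>u\<close>.\<close>

lemma jordan_operator_identity:
  "jp (jp (jp x x) y) u = jp (jp x x) (jp y u) + 2 *\<^sub>R jp (jp x y) (jp x u) - 2 *\<^sub>R jp x (jp y (jp x u))"
proof -
  \<comment> \<open>\<open>T X S\<close> is the commutator of the multiplications by
    \<open>X\<close> and \<open>S\<close>, applied to \<open>y\<close>. The Jordan axiom is expanded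
    at \<open>x + u\<close> and \<open>x - u\<close>; the difference keeps the terms of odd degree
    in \<open>u\<close>, and the cubic one vanishes by the axiom at \<open>u\<close>.\<close>
  define T where "T X S = jp X (jp S y) - jp S (jp X y)" for X S
  have T_add: "T (X + X') S = T X S + T X' S" "T X (S + S') = T X S + T X S'"
    and T_diff: "T (X - X') S = T X S - T X' S" "T X (S - S') = T X S - T X S'"
    and T_scale: "T X (r *\<^sub>R S) = r *\<^sub>R T X S" for X X' S S' r
    by (simp_all add: T_def jp_distribs algebra_simps)
  have T0: "T X (jp X X) = 0" for X
    using jordan[of X y] by (simp add: T_def)
  define w where "w = jp x u"
  have sq: "jp (x + u) (x + u) = jp x x + 2 *\<^sub>R w + jp u u"
           "jp (x - u) (x - u) = jp x x - 2 *\<^sub>R w + jp u u"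
    unfolding w_def using commute[of u x] by (simp_all add: jp_distribs scaleR_2)
  have P: "T x (jp x x) + 2 *\<^sub>R T x w + T x (jp u u) + (T u (jp x x) + 2 *\<^sub>R T u w + T u (jp u u)) = 0"
    (is "?P = 0")
    using T0[of "x + u"] unfolding sq by (simp add: T_add T_scale algebra_simps)
  have Q: "T x (jp x x) - 2 *\<^sub>R T x w + T x (jp u u) - (T u (jp x x) - 2 *\<^sub>R T u w + T u (jp u u)) = 0"
    (is "?Q = 0")
    using T0[of "x - u"] unfolding sq by (simp add: T_add T_diff T_scale algebra_simps)
  have "2 *\<^sub>R (2 *\<^sub>R T x w + T u (jp x x)) = ?P - ?Q"
    unfolding T0 by (simp add: algebra_simps scaleR_2)
  then have "2 *\<^sub>R (2 *\<^sub>R T x w + T u (jp x x)) = 0"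
    unfolding P Q by simp
  then have "2 *\<^sub>R T x w + T u (jp x x) = 0" by simp
  moreover have "jp (jp (jp x x) y) u = jp u (jp (jp x x) y)" "jp y u = jp u y"
    "jp (jp x y) (jp x u) = jp w (jp x y)" "jp x (jp y (jp x u)) = jp x (jp w y)"
    unfolding w_def using commute by metis+
  ultimately show ?thesis
    by (simp add: T_def algebra_simps)
qed

lemma idempotent_operator_identity:
  assumes "jp c c = c"
  shows "jp c u = 3 *\<^sub>R jp c (jp c u) - 2 *\<^sub>R jp c (jp c (jp c u))"
proof -
  have "(3::real) *\<^sub>R v = v + 2 *\<^sub>R v" for v :: 'a
    by (simp flip: scaleR_add_left[of 1 2, simplified])
  then show ?thesis using jordan_operator_identity[of c c u] assms by simp
qed

text \<open>The operator \<open>T\<close> of multiplication by an idempotent satisfies \<open>T (2 T - 1) (T - 1) = 0\<close>, and on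
  the roots \<open>0, 1/2, 1\<close> one has \<open>t = (t (2 t - 1))\<^sup>2 + 8 (t (1 - t))\<^sup>2\<close>.\<close>

lemma idempotent_psd:
  assumes "jp c c = c"
  shows "jp c u \<bullet> u \<ge> 0"
proof -
  define p where "p = jp c u"
  define q where "q = jp c p"
  define r where "r = jp c q"
  define s where "s = jp c r"
  have "p = 3 *\<^sub>R q - 2 *\<^sub>R r" "q = 3 *\<^sub>R r - 2 *\<^sub>R s"
    using idempotent_operator_identity[OF assms] by (simp_all add: p_def q_def r_def s_def)
  then have rel: "p \<bullet> u = 3 * (q \<bullet> u) - 2 * (r \<bullet> u)" "q \<bullet> u = 3 * (r \<bullet> u) - 2 * (s \<bullet> u)"
    by (metis inner_diff_left inner_scaleR_left)+
  have prods: "p \<bullet> p = q \<bullet> u" "q \<bullet> p = r \<bullet> u" "q \<bullet> q = s \<bullet> u"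
    unfolding p_def q_def r_def s_def by (simp_all add: jp_symmetric)
  have "0 \<le> (2 *\<^sub>R q - p) \<bullet> (2 *\<^sub>R q - p) + 8 * ((p - q) \<bullet> (p - q))" by simp
  also have "\<dots> = 12 * (q \<bullet> q) - 20 * (q \<bullet> p) + 9 * (p \<bullet> p)"
    by (simp add: inner_diff_left inner_diff_right inner_commute[of p q])
  also have "\<dots> = p \<bullet> u" using rel unfolding prods by linarith
  finally show ?thesis by (simp add: p_def)
qed

lemma bilinear_jp_inner: "bilinear (\<lambda>u v. jp u v \<bullet> z)"
  unfolding bilinear_def by (auto intro!: linearI simp: jp_distribs inner_add_left)

text \<open>For an idempotent \<open>u\<close> the hypothesis just says that \<open>c\<close> and
  \<open>u\<close> are orthogonal vectors; this promotes it to a vanishing product, because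
  isotropic vectors lie in the radical.\<close>

lemma idempotent_psd_kernel:
  assumes c: "jp c c = c" and "jp c u \<bullet> u = 0"
  shows "jp c u = 0"
proof -
  define B where "B = (\<lambda>u v. jp u v \<bullet> c)"
  have B_eq: "B u v = jp c u \<bullet> v" for u v
    unfolding B_def using inner_assoc[of u v c] jp_symmetric[of c u v] commute[of u c] commute[of v c] by metis
  have "B u v = 0" for v
  proof (rule psd_form_kernel[of B UNIV])
    show "bilinear B" unfolding B_def by (rule bilinear_jp_inner)
    show "B u u \<ge> 0" for u unfolding B_eq by (rule idempotent_psd[OF c])
    show "B u v = B v u" for u v unfolding B_def using commute by metis
    show "B u u = 0" using assms(2) by (simp add: B_eq)
  qed auto
  then show ?thesis unfolding B_eq using inner_eq_zero_iff by blast
qed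

section \<open>Powers of an element and the associative algebra they generate\<close>

definition jpow :: "'a \<Rightarrow> nat \<Rightarrow> 'a" where
  "jpow x n = (jp x ^^ n) e"

lemma jpow_0 [simp]: "jpow x 0 = e"
  and jpow_Suc [simp]: "jpow x (Suc n) = jp x (jpow x n)"
  by (simp_all add: jpow_def)

text \<open>With \<open>p = jpow x m\<close>, the power \<open>m + 2\<close> is the product of
  \<open>jp x x\<close> and \<open>p\<close>, so the polarised identity expresses its multiplication
  operator through those of \<open>x\<close>, \<open>jp x x\<close>, \<open>p\<close> and
  \<open>jp x p\<close>. The square enters this recursion, which is why commutation with it is
  proved alongside.\<close>

lemma jpow_operators_commute:
  "(\<forall>u. jp (jpow x n) (jp x u) = jp x (jp (jpow x n) u)) \<and>
   (\<forall>u. jp (jpow x n) (jp (jp x x) u) = jp (jp x x) (jp (jpow x n) u))"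
proof (induction n rule: less_induct)
  case (less n)
  have xx: "jp (jp x x) (jp x u) = jp x (jp (jp x x) u)" for u using jordan[of x u] by simp
  consider "n = 0" | "n = 1" | m where "n = Suc (Suc m)"
    by (metis One_nat_def not0_implies_Suc)
  then show ?case
  proof cases
    case 1
    then show ?thesis by (simp add: identity)
  next
    case 2
    then show ?thesis by (simp add: identity_right xx)
  next
    case 3
    define p where "p = jpow x m"
    have p: "jp p (jp x u) = jp x (jp p u)" "jp p (jp (jp x x) u) = jp (jp x x) (jp p u)" for u
      using less.IH[of m] 3 by (auto simp: p_def)
    have q: "jp (jp x p) (jp x u) = jp x (jp (jp x p) u)"
      "jp (jp x p) (jp (jp x x) u) = jp (jp x x) (jp (jp x p) u)" for u
      using less.IH[of "Suc m"] 3 by (auto simp: p_def)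
    have "jpow x n = jp (jp x x) p"
      using p(1)[of x] commute[of p] by (simp add: 3 p_def)
    then have n: "jp (jpow x n) u = jp (jp x x) (jp p u) + 2 *\<^sub>R jp (jp x p) (jp x u) - 2 *\<^sub>R jp x (jp p (jp x u))" for u
      using jordan_operator_identity[of x p u] by simp
    show ?thesis unfolding n by (simp add: p q xx jp_distribs)
  qed
qed

lemma jpow_mult: "jp (jpow x m) (jpow x n) = jpow x (m + n)"
  by (induction n) (simp_all add: identity_right jpow_operators_commute)

definition generated :: "'a \<Rightarrow> 'a set" where
  "generated x = span (range (jpow x))"

lemma subspace_generated: "subspace (generated x)"
  unfolding generated_def by (rule subspace_span)

lemma jpow_in_generated: "jpow x n \<in> generated x"
  unfolding generated_def by (intro span_base) simp

lemma e_in_generated: "e \<in> generated x"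
  using jpow_in_generated[of x 0] by simp

lemma self_in_generated: "x \<in> generated x"
  using jpow_in_generated[of x 1] by (simp add: identity_right)

lemma generated_induct [consumes 1, case_names subspace power]:
  assumes "u \<in> generated x" "subspace {u. P u}" "\<And>n. P (jpow x n)"
  shows "P u"
  using span_induct[of u "range (jpow x)" P] assms unfolding generated_def by blast

lemma jp_in_generated:
  assumes "u \<in> generated x" "v \<in> generated x"
  shows "jp u v \<in> generated x"
  using assms(1)
proof (induction rule: generated_induct)
  case subspace
  show ?case
    using subspace_generated[of x] by (auto simp: subspace_def jp_distribs)
next
  case (power n)
  show ?case using assms(2)
  proof (induction rule: generated_induct)
    case subspace
    show ?case
      using subspace_generated[of x] by (auto simp: subspace_def jp_distribs)
  qed (simp add: jpow_mult jpow_in_generated)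
qed

lemma generated_assoc:
  assumes "u \<in> generated x" "v \<in> generated x" "w \<in> generated x"
  shows "jp u (jp v w) = jp (jp u v) w"
  using assms(1)
proof (induction rule: generated_induct)
  case subspace
  show ?case by (auto simp: subspace_def jp_distribs)
next
  case (power n)
  show ?case using assms(2)
  proof (induction rule: generated_induct)
    case subspace
    show ?case by (auto simp: subspace_def jp_distribs)
  next
    case (power m)
    show ?case using assms(3)
    proof (induction rule: generated_induct)
      case subspace
      show ?case by (auto simp: subspace_def jp_distribs)
    qed (simp add: jpow_mult add.assoc)
  qed
qed

lemma generated_eigenvector:
  assumes "u \<in> generated x" "v \<in> generated x" "jp x v = \<mu> *\<^sub>R v"
  shows "\<exists>r. jp u v = r *\<^sub>R v"
  using assms(1)
proof (induction rule: generated_induct)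
  case subspace
  have "\<exists>t. r *\<^sub>R v + s *\<^sub>R v = t *\<^sub>R v" for r s by (metis scaleR_left_distrib)
  then show ?case by (auto simp: subspace_def jp_distribs intro: exI[of _ 0])
next
  case (power n)
  show ?case
  proof (induction n)
    case 0
    then show ?case by (auto simp: identity intro: exI[of _ 1])
  next
    case (Suc n)
    then obtain r where "jp (jpow x n) v = r *\<^sub>R v" by blast
    then have "jp (jpow x (Suc n)) v = (r * \<mu>) *\<^sub>R v"
      using generated_assoc[OF self_in_generated jpow_in_generated assms(2), of n] assms(3)
      by (simp add: jp_distribs)
    then show ?case by blast
  qed
qed

section \<open>Complete systems of orthogonal idempotents\<close>

text \<open>Summing to \<open>e\<close> is left out so that partial systems can be compared by size.
  Two maximality arguments use this: one over systems inside the generated algebra, to reach the sum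
  \<open>e\<close>, and one over systems with that sum, to reach primitivity.\<close>

definition eigen_system :: "'a \<Rightarrow> 'a set \<Rightarrow> bool" where
  "eigen_system x S \<longleftrightarrow> finite S \<and> (\<forall>c\<in>S. c \<noteq> 0 \<and> jp c c = c \<and> (\<exists>l. jp x c = l *\<^sub>R c)) \<and>
     (\<forall>c\<in>S. \<forall>d\<in>S. c \<noteq> d \<longrightarrow> jp c d = 0)"

lemma orthogonal_idempotents_inner:
  assumes "jp c c = c" "jp c d = 0"
  shows "c \<bullet> d = 0"
  using inner_assoc[of c c d] assms by simp

lemma eigen_system_card:
  assumes "eigen_system x S"
  shows "card S \<le> DIM('a)"
proof -
  have "pairwise orthogonal S"
    using assms orthogonal_idempotents_inner
    unfolding eigen_system_def pairwise_def orthogonal_def by blast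
  moreover have "0 \<notin> S" using assms by (auto simp: eigen_system_def)
  ultimately have "independent S" by (rule pairwise_orthogonal_independent)
  then show ?thesis using independent_bound by blast
qed

lemma ex_max_card_eigen_system:
  assumes "P S" "eigen_system x S"
  obtains S' where "P S'" "eigen_system x S'"
    "\<And>S''. P S'' \<Longrightarrow> eigen_system x S'' \<Longrightarrow> card S'' \<le> card S'"
proof -
  have "\<exists>S'. (P S' \<and> eigen_system x S') \<and> (\<forall>S''. P S'' \<and> eigen_system x S'' \<longrightarrow> card S'' \<le> card S')"
    using assms eigen_system_card[of x]
    by (intro ex_has_greatest_nat[of _ S _ "Suc DIM('a)"]) (auto simp: less_Suc_eq_le)
  then show ?thesis using that by blast
qed

lemma eigen_system_insert:
  assumes "eigen_system x S" "c \<noteq> 0" "jp c c = c" "jp x c = l *\<^sub>R c" "\<And>d. d \<in> S \<Longrightarrow> jp d c = 0"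
  shows "eigen_system x (insert c S)"
  unfolding eigen_system_def
proof (intro conjI ballI impI)
  show "finite (insert c S)" using assms(1) by (simp add: eigen_system_def)
next
  fix d assume "d \<in> insert c S"
  then show "d \<noteq> 0" "jp d d = d" "\<exists>l. jp x d = l *\<^sub>R d" using assms by (auto simp: eigen_system_def)
next
  fix d d' assume d: "d \<in> insert c S" "d' \<in> insert c S" "d \<noteq> d'"
  show "jp d d' = 0"
  proof (cases "d = c")
    case True
    then have "jp d' d = 0" using d assms(5) by blast
    then show ?thesis using commute by metis
  next
    case False
    then show ?thesis using d assms(1,5) by (auto simp: eigen_system_def)
  qed
qed

text \<open>An eigenvector \<open>v\<close> of \<open>L(x)\<close> inside the algebra generated by \<open>x\<close> satisfies \<open>v o v = r v\<close> with \<open>r \<noteq> 0\<close>, so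
  rescaling it gives an idempotent; a maximal system of these must sum to \<open>e\<close>.\<close>

lemma complete_eigen_system_exists:
  obtains S where "eigen_system x S" "\<Sum>S = e"
proof -
  have "eigen_system x {}" by (simp add: eigen_system_def)
  then obtain S where S: "S \<subseteq> generated x" "eigen_system x S"
    and max: "\<And>S'. S' \<subseteq> generated x \<Longrightarrow> eigen_system x S' \<Longrightarrow> card S' \<le> card S"
    using ex_max_card_eigen_system[of "\<lambda>S. S \<subseteq> generated x" "{}" x] by blast
  have fin: "finite S" using S(2) by (simp add: eigen_system_def)
  \<comment> \<open>The part of the generated algebra annihilated by the system. Associativity makes
    it invariant under multiplication by \<open>x\<close>, and it contains the defect
    \<open>e - \<Sum>S\<close>, so a nonzero defect produces an eigenvector in it.\<close>
  define W where "W = {w \<in> generated x. \<forall>c\<in>S. jp c w = 0}"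
  have W: "subspace W"
    unfolding W_def using subspace_generated[of x] by (auto simp: subspace_def jp_distribs)
  have inv: "jp x w \<in> W" if "w \<in> W" for w
  proof -
    have w: "w \<in> generated x" "\<And>c. c \<in> S \<Longrightarrow> jp c w = 0" using that by (auto simp: W_def)
    have "jp c (jp x w) = 0" if "c \<in> S" for c
    proof -
      have c: "c \<in> generated x" using that S(1) by blast
      have "jp c (jp x w) = jp (jp x c) w"
        using generated_assoc[OF c self_in_generated w(1)] commute[of c x] by simp
      also have "\<dots> = jp x (jp c w)"
        using generated_assoc[OF self_in_generated c w(1)] by simp
      finally show ?thesis using w(2)[OF that] by (simp add: jp_zero_right)
    qed
    then show ?thesis using w jp_in_generated self_in_generated by (simp add: W_def)
  qed
  have "\<Sum>S \<in> generated x"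
    using S(1) subspace_generated by (intro subspace_sum) auto
  then have "e - \<Sum>S \<in> generated x"
    using e_in_generated subspace_generated by (simp add: subspace_diff)
  moreover have "jp c (e - \<Sum>S) = 0" if "c \<in> S" for c
  proof -
    have "jp c (\<Sum>S) = (\<Sum>d\<in>S. jp c d)" by (rule jp_sum_right)
    also have "\<dots> = (\<Sum>d\<in>S. if d = c then c else 0)"
      using S(2) that by (intro sum.cong) (auto simp: eigen_system_def)
    also have "\<dots> = c" using fin that by simp
    finally show ?thesis by (simp add: jp_distribs identity_right)
  qed
  ultimately have rest: "e - \<Sum>S \<in> W" by (simp add: W_def)
  have "e - \<Sum>S = 0"
  proof (rule ccontr)
    assume "e - \<Sum>S \<noteq> 0"
    then obtain v \<mu> where v: "v \<in> W" "v \<noteq> 0" "jp x v = \<mu> *\<^sub>R v"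
      using symmetric_eigenvector[OF linear_jp jp_symmetric W inv rest] by blast
    have vg: "v \<in> generated x" using v(1) by (simp add: W_def)
    obtain r where r: "jp v v = r *\<^sub>R v"
      using generated_eigenvector[OF vg vg v(3)] by blast
    have "r \<noteq> 0"
    proof
      assume "r = 0"
      then have "v \<bullet> v = 0"
        using inner_assoc[of v v e] r by (simp add: identity_right)
      then show False using v(2) by simp
    qed
    define c where "c = (1 / r) *\<^sub>R v"
    have c: "c \<noteq> 0" "jp c c = c" "jp x c = \<mu> *\<^sub>R c"
      using v(2,3) r \<open>r \<noteq> 0\<close> by (simp_all add: c_def jp_distribs)
    have cW: "c \<in> W" unfolding c_def using v(1) W by (simp add: subspace_mul)
    have "eigen_system x (insert c S)"
      using eigen_system_insert[OF S(2) c] cW by (simp add: W_def)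
    moreover have "insert c S \<subseteq> generated x" using S(1) cW by (simp add: W_def)
    ultimately have "card (insert c S) \<le> card S" by (intro max)
    then have "c \<in> S" using fin by (auto simp: card_insert_if split: if_splits)
    then have "jp c c = 0" using cW by (simp add: W_def)
    then show False using c by simp
  qed
  then show ?thesis using that[OF S(2)] by simp
qed

text \<open>In a system of maximal size with sum \<open>e\<close>, a splitting
  \<open>c = p + q\<close> would allow replacing \<open>c\<close> by two elements. Any other member
  \<open>d\<close> annihilates both: its inner products with \<open>p\<close> and \<open>q\<close>
  are nonnegative and add up to its inner product with \<open>c\<close>, which is 0.\<close>

lemma primitive_eigen_system_exists:
  obtains S where "eigen_system x S" "\<Sum>S = e" "\<And>c. c \<in> S \<Longrightarrow> primitive_idempotent jp c"
proof -
  obtain S0 where "eigen_system x S0" "\<Sum>S0 = e" by (rule complete_eigen_system_exists)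
  then obtain S where S: "\<Sum>S = e" "eigen_system x S"
    and max: "\<And>S'. \<Sum>S' = e \<Longrightarrow> eigen_system x S' \<Longrightarrow> card S' \<le> card S"
    using ex_max_card_eigen_system[of "\<lambda>S. \<Sum>S = e" S0 x] by blast
  have fin: "finite S" using S(2) by (simp add: eigen_system_def)
  have "primitive_idempotent jp c" if "c \<in> S" for c
    unfolding primitive_idempotent_def idempotent_def
  proof (intro conjI notI)
    show "jp c c = c" using S(2) that by (simp add: eigen_system_def)
    show "c = 0 \<Longrightarrow> False" using S(2) that unfolding eigen_system_def by blast
    assume "\<exists>c' c''. jp c' c' = c' \<and> jp c'' c'' = c'' \<and> c' \<noteq> 0 \<and> c'' \<noteq> 0 \<and> c = c' + c''"
    then obtain p q where pq: "jp p p = p" "jp q q = q" "p \<noteq> 0" "q \<noteq> 0" "c = p + q" by blast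
    have "p + q = p + 2 *\<^sub>R jp p q + q"
      using \<open>jp c c = c\<close> pq(1,2,5) commute[of q p] by (simp add: jp_distribs scaleR_2 algebra_simps)
    then have pq0: "jp p q = 0" by simp
    have d0: "jp d p = 0 \<and> jp d q = 0" if d: "d \<in> S" "d \<noteq> c" for d
    proof -
      have dd: "jp d d = d" "jp d c = 0" using d \<open>c \<in> S\<close> S(2) by (auto simp: eigen_system_def)
      have eq: "jp d w \<bullet> w = d \<bullet> w" if "jp w w = w" for w
        using that inner_assoc[of d w w] by simp
      have "d \<bullet> p + d \<bullet> q = 0"
        using orthogonal_idempotents_inner[OF dd] by (simp add: pq(5) inner_add_right)
      then have "d \<bullet> p = 0 \<and> d \<bullet> q = 0"
        using idempotent_psd[OF dd(1), of p] idempotent_psd[OF dd(1), of q] eq pq(1,2) by simp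
      then show ?thesis
        using idempotent_psd_kernel[OF dd(1)] eq pq(1,2) by simp
    qed
    define S1 where "S1 = S - {c}"
    obtain k where k: "\<And>d. d \<in> S \<Longrightarrow> jp x d = k d *\<^sub>R d"
      using S(2) unfolding eigen_system_def by metis
    have x_eq: "x = (\<Sum>d\<in>S. k d *\<^sub>R d)"
    proof -
      have "x = jp x (\<Sum>S)" using S(1) by (simp add: identity_right)
      also have "\<dots> = (\<Sum>d\<in>S. k d *\<^sub>R d)" unfolding jp_sum_right by (intro sum.cong) (auto simp: k)
      finally show ?thesis .
    qed
    have x_part: "jp x w = k c *\<^sub>R w" if w: "jp c w = w" "\<And>d. d \<in> S \<Longrightarrow> d \<noteq> c \<Longrightarrow> jp d w = 0" for w
    proof -
      have "jp x w = (\<Sum>d\<in>S. k d *\<^sub>R jp d w)"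
        by (subst x_eq) (simp add: jp_sum_left jp_scaleR_left)
      also have "\<dots> = (\<Sum>d\<in>S. if d = c then k c *\<^sub>R w else 0)"
        using w by (intro sum.cong) auto
      also have "\<dots> = k c *\<^sub>R w" using fin \<open>c \<in> S\<close> by simp
      finally show ?thesis .
    qed
    have cp: "jp c p = p" "jp c q = q"
      using pq pq0 commute[of q p] by (auto simp: jp_distribs)
    have S1: "eigen_system x S1" using S(2) by (auto simp: S1_def eigen_system_def)
    have sysq: "eigen_system x (insert q S1)"
      using pq d0 x_part[of q] cp by (intro eigen_system_insert[OF S1]) (auto simp: S1_def)
    have sys: "eigen_system x (insert p (insert q S1))"
      using pq d0 x_part[of p] cp pq0 commute[of q p]
      by (intro eigen_system_insert[OF sysq]) (auto simp: S1_def)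
    have "q \<notin> S1" using d0 pq by (force simp: S1_def)
    moreover have "p \<notin> insert q S1" using d0 pq pq0 by (force simp: S1_def)
    moreover have "finite S1" using fin by (simp add: S1_def)
    moreover have "e = c + \<Sum>S1" using S(1) fin \<open>c \<in> S\<close> by (simp add: S1_def sum.remove)
    ultimately have "\<Sum>(insert p (insert q S1)) = e" "card (insert p (insert q S1)) = Suc (Suc (card S1))"
      by (simp_all add: pq(5) add.assoc)
    moreover have "card S = Suc (card S1)"
      using fin \<open>c \<in> S\<close> unfolding S1_def by (rule card.remove)
    ultimately show False using max[OF _ sys] by simp
  qed
  then show ?thesis using that S by blast
qed

section \<open>Eigenvalues and self-duality\<close>

lemma spectral_decomposition_exists: "\<exists>r l c. spectral_decomposition jp e x r l c"
proof -
  obtain S where S: "eigen_system x S" "\<Sum>S = e" "\<And>c. c \<in> S \<Longrightarrow> primitive_idempotent jp c"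
    by (rule primitive_eigen_system_exists[of x]) blast
  have "finite S" using S(1) by (simp add: eigen_system_def)
  then obtain h where h: "bij_betw h {..<card S} S"
    using ex_bij_betw_nat_finite lessThan_atLeast0 by metis
  obtain k where k: "\<And>d. d \<in> S \<Longrightarrow> jp x d = k d *\<^sub>R d"
    using S(1) unfolding eigen_system_def by metis
  have hS: "h i \<in> S" if "i < card S" for i using h that by (auto simp: bij_betw_def)
  have inj: "h i \<noteq> h j" if "i < card S" "j < card S" "i \<noteq> j" for i j
    using h that by (auto simp: bij_betw_def inj_on_def)
  have sum: "(\<Sum>i<card S. h i) = e"
    using sum.reindex_bij_betw[OF h, of "\<lambda>c. c"] S(2) by simp
  have "x = jp x (\<Sum>i<card S. h i)" using sum by (simp add: identity_right)
  also have "\<dots> = (\<Sum>i<card S. k (h i) *\<^sub>R h i)"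
    unfolding jp_sum_right using hS k by (intro sum.cong) auto
  finally have "spectral_decomposition jp e x (card S) (\<lambda>i. k (h i)) h"
    unfolding spectral_decomposition_def using S(1,3) hS inj sum by (auto simp: eigen_system_def)
  then show ?thesis by blast
qed

lemma spectral_decomposition_simps:
  assumes "spectral_decomposition jp e x r l c"
  shows "i < r \<Longrightarrow> c i \<noteq> 0" "i < r \<Longrightarrow> jp (c i) (c i) = c i"
    "i < r \<Longrightarrow> j < r \<Longrightarrow> i \<noteq> j \<Longrightarrow> jp (c i) (c j) = 0"
    "(\<Sum>i<r. c i) = e" "x = (\<Sum>i<r. l i *\<^sub>R c i)" "i < r \<Longrightarrow> jp x (c i) = l i *\<^sub>R c i"
proof -
  show 1: "c i \<noteq> 0" "jp (c i) (c i) = c i" if "i < r" for i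
    using assms that by (auto simp: spectral_decomposition_def primitive_idempotent_def idempotent_def)
  show 2: "jp (c i) (c j) = 0" if "i < r" "j < r" "i \<noteq> j" for i j
    using assms that by (auto simp: spectral_decomposition_def)
  show "(\<Sum>i<r. c i) = e" and 3: "x = (\<Sum>i<r. l i *\<^sub>R c i)"
    using assms by (auto simp: spectral_decomposition_def)
  show "jp x (c i) = l i *\<^sub>R c i" if "i < r"
  proof -
    have "jp x (c i) = (\<Sum>j<r. l j *\<^sub>R jp (c j) (c i))"
      by (subst 3) (simp add: jp_sum_left jp_scaleR_left)
    also have "\<dots> = (\<Sum>j<r. if j = i then l i *\<^sub>R c i else 0)"
      using 1 2 that by (intro sum.cong) auto
    also have "\<dots> = l i *\<^sub>R c i" using that by simp
    finally show ?thesis .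
  qed
qed

text \<open>Eigenvectors of the symmetric map \<open>jp x\<close> for distinct eigenvalues are
  orthogonal. If the eigenvalue of \<open>c i\<close> were missing from the second decomposition,
  \<open>c i\<close> would be orthogonal to every \<open>c' j\<close>, hence to \<open>e\<close>,
  although its product with \<open>e\<close> is its squared norm.\<close>

lemma spectral_eigenvalues_subset:
  assumes "spectral_decomposition jp e x r l c" "spectral_decomposition jp e x r' l' c'"
  shows "l ` {..<r} \<subseteq> l' ` {..<r'}"
proof
  fix t assume "t \<in> l ` {..<r}"
  then obtain i where i: "i < r" "t = l i" by blast
  note c = spectral_decomposition_simps[OF assms(1)] and c' = spectral_decomposition_simps[OF assms(2)]
  show "t \<in> l' ` {..<r'}"
  proof (rule ccontr)
    assume t: "t \<notin> l' ` {..<r'}"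
    have "c i \<bullet> c' j = 0" if j: "j < r'" for j
    proof -
      have "l i * (c i \<bullet> c' j) = l' j * (c i \<bullet> c' j)"
        using jp_symmetric[of x "c i" "c' j"] c(6)[OF i(1)] c'(6)[OF j] by simp
      moreover have "l i \<noteq> l' j" using t i j by auto
      ultimately show ?thesis by simp
    qed
    then have "c i \<bullet> e = 0"
      by (simp add: inner_sum_right flip: c'(4))
    then have "c i \<bullet> c i = 0"
      using inner_assoc[of "c i" "c i" e] c(2)[OF i(1)] by (simp add: identity_right)
    then show False using c(1)[OF i(1)] by simp
  qed
qed

lemma lambda_min_eq:
  assumes "spectral_decomposition jp e x r l c"
  shows "lambda_min jp e x = Min (l ` {..<r})"
  unfolding lambda_min_def
  using assms spectral_eigenvalues_subset by (intro the_equality) (metis subset_antisym)+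

lemma square_spectral:
  assumes "spectral_decomposition jp e x r l c"
  shows "jp x x = (\<Sum>i<r. (l i)\<^sup>2 *\<^sub>R c i)"
proof -
  note c = spectral_decomposition_simps[OF assms]
  have "jp x x = (\<Sum>i<r. l i *\<^sub>R jp x (c i))"
    by (subst (2) c(5)) (simp add: jp_sum_right jp_scaleR_right)
  also have "\<dots> = (\<Sum>i<r. (l i)\<^sup>2 *\<^sub>R c i)"
    using c(6) by (intro sum.cong) (auto simp: power2_eq_square)
  finally show ?thesis .
qed

lemma square_inner_square_nonneg: "jp x x \<bullet> jp y y \<ge> 0"
proof -
  obtain r l c where d: "spectral_decomposition jp e x r l c"
    using spectral_decomposition_exists by blast
  have "c i \<bullet> jp y y \<ge> 0" if "i < r" for i
    using idempotent_psd[OF spectral_decomposition_simps(2)[OF d that], of y] inner_assoc[of "c i" y y] by simp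
  then show ?thesis
    unfolding square_spectral[OF d] by (auto simp: inner_sum_left intro!: sum_nonneg)
qed

lemma nonneg_eigenvalues_imp_square:
  assumes "spectral_decomposition jp e x r l c" "\<And>i. i < r \<Longrightarrow> l i \<ge> 0"
  shows "x \<in> cone_of_squares jp"
proof -
  note c = spectral_decomposition_simps[OF assms(1)]
  define y where "y = (\<Sum>i<r. sqrt (l i) *\<^sub>R c i)"
  have "spectral_decomposition jp e y r (\<lambda>i. sqrt (l i)) c"
    using assms(1) unfolding spectral_decomposition_def y_def by simp
  then have "jp y y = (\<Sum>i<r. (sqrt (l i))\<^sup>2 *\<^sub>R c i)" by (rule square_spectral)
  also have "\<dots> = x" using assms(2) by (subst c(5)) (intro sum.cong, auto)
  finally show ?thesis unfolding cone_of_squares_def by blast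
qed

text \<open>For the harder inclusion, pair \<open>x\<close> with the squares
  \<open>c i = jp (c i) (c i)\<close> from its own decomposition: the result is \<open>l i\<close>
  times a positive number, so all eigenvalues are nonnegative and have square roots.\<close>

lemma cone_of_squares_self_dual: "cone_of_squares jp = dual_cone (cone_of_squares jp)"
proof (intro subset_antisym subsetI)
  fix x assume "x \<in> cone_of_squares jp"
  then show "x \<in> dual_cone (cone_of_squares jp)"
    using square_inner_square_nonneg by (auto simp: dual_cone_def cone_of_squares_def)
next
  fix x assume x: "x \<in> dual_cone (cone_of_squares jp)"
  obtain r l c where d: "spectral_decomposition jp e x r l c"
    using spectral_decomposition_exists by blast
  note c = spectral_decomposition_simps[OF d]
  have "l i \<ge> 0" if i: "i < r" for i
  proof -
    have "jp (c i) (c i) \<in> cone_of_squares jp" by (simp add: cone_of_squares_def)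
    then have "0 \<le> x \<bullet> c i" using x c(2)[OF i] by (auto simp: dual_cone_def)
    also have "x \<bullet> c i = jp x (c i) \<bullet> c i" using inner_assoc[of x "c i" "c i"] c(2)[OF i] by simp
    also have "\<dots> = l i * (c i \<bullet> c i)" using c(6)[OF i] by simp
    finally show ?thesis
      using c(1)[OF i] by (metis inner_gt_zero_iff not_less zero_le_mult_iff)
  qed
  then show "x \<in> cone_of_squares jp" using nonneg_eigenvalues_imp_square[OF d] by blast
qed

text \<open>Being its own dual, the cone is an intersection of closed half-spaces through 0.\<close>

lemma cone_of_squares_closed_convex_cone:
  "closed (cone_of_squares jp)" "convex (cone_of_squares jp)" "cone (cone_of_squares jp)"
proof -
  have eq: "cone_of_squares jp = (\<Inter>y\<in>cone_of_squares jp. {x. y \<bullet> x \<ge> 0})"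
    by (subst cone_of_squares_self_dual) (auto simp: dual_cone_def inner_commute)
  show "closed (cone_of_squares jp)"
    by (subst eq) (auto intro: closed_halfspace_ge)
  show "convex (cone_of_squares jp)"
    by (subst eq) (auto intro: convex_INT convex_halfspace_ge)
  show "cone (cone_of_squares jp)"
    by (subst cone_of_squares_self_dual) (auto simp: cone_def dual_cone_def)
qed

text \<open>Adding \<open>\<epsilon> *\<^sub>R e\<close> shifts every eigenvalue by
  \<open>\<epsilon>\<close>, which puts the point into the cone at the cost of that
  displacement.\<close>

lemma infdist_cone_of_squares_le:
  assumes "lambda_min jp e x \<ge> - \<epsilon>" "\<epsilon> \<ge> 0"
  shows "infdist x (cone_of_squares jp) \<le> norm e * \<epsilon>"
proof -
  obtain r l c where d: "spectral_decomposition jp e x r l c"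
    using spectral_decomposition_exists by blast
  note c = spectral_decomposition_simps[OF d]
  have "x + \<epsilon> *\<^sub>R e = (\<Sum>i<r. (l i + \<epsilon>) *\<^sub>R c i)"
    by (subst c(5), subst c(4)[symmetric]) (simp add: scaleR_sum_right scaleR_left_distrib sum.distrib)
  then have "spectral_decomposition jp e (x + \<epsilon> *\<^sub>R e) r (\<lambda>i. l i + \<epsilon>) c"
    using d unfolding spectral_decomposition_def by simp
  moreover have "l i + \<epsilon> \<ge> 0" if "i < r" for i
  proof -
    have "Min (l ` {..<r}) \<le> l i" using that by (intro Min_le) auto
    then show ?thesis using assms(1) lambda_min_eq[OF d] by simp
  qed
  ultimately have "x + \<epsilon> *\<^sub>R e \<in> cone_of_squares jp"
    by (rule nonneg_eigenvalues_imp_square)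
  then show ?thesis
    using infdist_le2[of "x + \<epsilon> *\<^sub>R e" "cone_of_squares jp" x] assms(2) by (simp add: dist_norm mult.commute)
qed

end

section \<open>Error bounds along facial reduction\<close>

lemma dyadic_powr_bounds:
  fixes \<epsilon> :: real
  assumes "0 < \<epsilon>" "\<epsilon> \<le> 1"
  shows "\<epsilon> \<le> \<epsilon> powr (2 powr (- real k)) \<and> 0 < \<epsilon> powr (2 powr (- real k)) \<and> \<epsilon> powr (2 powr (- real k)) \<le> 1"
proof (intro conjI)
  have "(2::real) powr (- real k) \<le> 2 powr 0" by (intro powr_mono) auto
  then have "\<epsilon> powr 1 \<le> \<epsilon> powr (2 powr (- real k))"
    using assms by (intro powr_mono') auto
  then show "\<epsilon> \<le> \<epsilon> powr (2 powr (- real k))" using assms(1) by simp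
  show "0 < \<epsilon> powr (2 powr (- real k))" using assms(1) by simp
  show "\<epsilon> powr (2 powr (- real k)) \<le> 1" using assms by (intro powr_le1) auto
qed

lemma facial_chain_subset:
  fixes F :: "nat \<Rightarrow> 'b set"
  assumes "\<And>i. i \<in> {1..k} \<Longrightarrow> F (i + 1) \<subseteq> F i"
  shows "F (k + 1) \<subseteq> F 1"
  using assms
proof (induction k)
  case (Suc k)
  then have "F (Suc k + 1) \<subseteq> F (k + 1)" using Suc.prems[of "k + 1"] by simp
  also have "\<dots> \<subseteq> F 1" using Suc.prems by (intro Suc.IH) auto
  finally show ?case .
qed simp

context euclidean_jordan_algebra
begin

lemma square_face_exposed:
  assumes "subspace V" and F: "F = (\<lambda>y. jp y y) ` V" and "z \<in> dual_cone F"
  shows "\<exists>V'. subspace V' \<and> F \<inter> {z}\<^sup>\<bottom> = (\<lambda>y. jp y y) ` V'"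
proof -
  have psd: "0 \<le> jp u u \<bullet> z" if "u \<in> V" for u
    using assms(3) that by (auto simp: F dual_cone_def inner_commute)
  have "subspace {y \<in> V. jp y y \<bullet> z = 0}"
    using psd by (intro psd_form_kernel_subspace[OF bilinear_jp_inner _ \<open>subspace V\<close>]) (metis commute)
  moreover have "F \<inter> {z}\<^sup>\<bottom> = (\<lambda>y. jp y y) ` {y \<in> V. jp y y \<bullet> z = 0}"
    by (auto simp: F orthogonal_comp_def orthogonal_def inner_commute)
  ultimately show ?thesis by blast
qed

text \<open>Write \<open>f = y o y\<close> with \<open>y \<in> V\<close> and project \<open>y\<close> to \<open>y0\<close> in the kernel of the form
  \<open>\<langle>y o y, z\<rangle>\<close>; then \<open>f - y0 o y0 = (y - y0) o (y + y0)\<close>.\<close>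

lemma square_face_residual:
  assumes "subspace V" and F: "F = (\<lambda>y. jp y y) ` V" and "z \<in> dual_cone F"
  shows "\<exists>c\<ge>0. \<forall>f\<in>F. \<exists>f'\<in>F \<inter> {z}\<^sup>\<bottom>. norm (f - f') \<le> c * sqrt (f \<bullet> z * norm f)"
proof -
  have psd: "0 \<le> jp u u \<bullet> z" if "u \<in> V" for u
    using assms(3) that by (auto simp: F dual_cone_def inner_commute)
  obtain c where c: "c \<ge> 0" "\<And>y. y \<in> V \<Longrightarrow>
      \<exists>y0\<in>V. jp y0 y0 \<bullet> z = 0 \<and> norm y0 \<le> norm y \<and> (norm (y - y0))\<^sup>2 \<le> c * (jp y y \<bullet> z)"
    using psd_form_growth[OF bilinear_jp_inner _ \<open>subspace V\<close>, of z] psd commute by metis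
  obtain b where b: "b > 0" "\<And>x y. norm (jp x y) \<le> b * norm x * norm y"
    using bilinear_bounded_pos[OF bilinear_jp] by blast
  show ?thesis
  \<comment> \<open>Here \<open>b\<close> bounds the product and \<open>c\<close> the growth of the
    form; \<open>norm e\<close> enters because the square of \<open>norm y\<close> is the inner
    product of \<open>f\<close> and \<open>e\<close>, and the 2 because \<open>norm (y + y0)\<close>
    is at most \<open>2 * norm y\<close>.\<close>
  proof (intro exI[of _ "2 * b * sqrt (c * norm e)"] conjI ballI)
    show "0 \<le> 2 * b * sqrt (c * norm e)" using b(1) c(1) by simp
  next
    fix f assume "f \<in> F"
    then obtain y where y: "y \<in> V" "f = jp y y" by (auto simp: F)
    obtain y0 where y0: "y0 \<in> V" "jp y0 y0 \<bullet> z = 0" "norm y0 \<le> norm y"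
      "(norm (y - y0))\<^sup>2 \<le> c * (jp y y \<bullet> z)"
      using c(2)[OF y(1)] by blast
    have "(norm y)\<^sup>2 = jp y y \<bullet> e"
      using inner_assoc[of y y e] by (simp add: identity_right power2_norm_eq_inner)
    also have "\<dots> \<le> norm f * norm e"
      unfolding y(2) by (rule norm_cauchy_schwarz)
    finally have ny: "norm y \<le> sqrt (norm f * norm e)" by (rule real_le_rsqrt)
    have nd: "norm (y - y0) \<le> sqrt (c * (f \<bullet> z))"
      using y0(4) by (auto simp: y(2) intro: real_le_rsqrt)
    have "f - jp y0 y0 = jp (y - y0) (y + y0)"
      using commute[of y0 y] by (simp add: y(2) jp_distribs)
    then have "norm (f - jp y0 y0) \<le> b * norm (y - y0) * norm (y + y0)"
      using b(2) by simp
    also have "\<dots> \<le> b * sqrt (c * (f \<bullet> z)) * (2 * sqrt (norm f * norm e))"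
      using nd ny b(1) c(1) y0(3) psd[OF y(1)] norm_triangle_ineq[of y y0]
      by (intro mult_mono) (auto simp: y(2))
    also have "\<dots> = 2 * b * sqrt (c * norm e) * sqrt (f \<bullet> z * norm f)"
      by (simp add: real_sqrt_mult mult_ac)
    finally have "norm (f - jp y0 y0) \<le> 2 * b * sqrt (c * norm e) * sqrt (f \<bullet> z * norm f)" .
    moreover have "jp y0 y0 \<in> F \<inter> {z}\<^sup>\<bottom>"
      using y0(1,2) by (auto simp: F orthogonal_comp_def orthogonal_def inner_commute)
    ultimately show "\<exists>f'\<in>F \<inter> {z}\<^sup>\<bottom>. norm (f - f') \<le> 2 * b * sqrt (c * norm e) * sqrt (f \<bullet> z * norm f)"
      by blast
  qed
qed

text \<open>The description of the face by a subspace travels along with the error bound, because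
  the square root estimate for the next step applies only to faces of that form. An actual point
  \<open>f\<close> is kept, as that estimate starts from a point of the face.\<close>

lemma facial_chain_residual:
  assumes "subspace L" "M \<ge> 0" "\<rho> \<ge> 0" and F1: "F 1 = cone_of_squares jp"
    and chain: "\<And>i. i \<in> {1..k} \<Longrightarrow> z i \<in> dual_cone (F i) \<inter> L\<^sup>\<bottom> \<inter> {a}\<^sup>\<bottom> \<and> F (i + 1) = F i \<inter> {z i}\<^sup>\<bottom>"
  shows "(\<exists>V. subspace V \<and> F (k + 1) = (\<lambda>y. jp y y) ` V) \<and>
    (\<exists>\<kappa>\<ge>0. \<forall>x \<epsilon>. 0 < \<epsilon> \<and> \<epsilon> \<le> 1 \<and> infdist x (cone_of_squares jp) \<le> M * \<epsilon> \<and>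
        infdist x (translate L a) \<le> \<epsilon> \<and> norm x \<le> \<rho> \<longrightarrow>
        (\<exists>f\<in>F (k + 1). norm (x - f) \<le> \<kappa> * \<epsilon> powr (2 powr (- real k))))"
  using chain
proof (induction k)
  case 0
  have "0 \<in> cone_of_squares jp"
    unfolding cone_of_squares_def using jp_zero_left by (metis rangeI)
  then have "\<exists>f\<in>cone_of_squares jp. norm (x - f) \<le> M * \<epsilon>" if "infdist x (cone_of_squares jp) \<le> M * \<epsilon>" for x \<epsilon>
    using infdist_le_imp_point[OF cone_of_squares_closed_convex_cone(1) _ that] by blast
  then have "\<exists>\<kappa>\<ge>0. \<forall>x \<epsilon>. 0 < \<epsilon> \<and> \<epsilon> \<le> 1 \<and> infdist x (cone_of_squares jp) \<le> M * \<epsilon> \<and>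
        infdist x (translate L a) \<le> \<epsilon> \<and> norm x \<le> \<rho> \<longrightarrow>
        (\<exists>f\<in>F 1. norm (x - f) \<le> \<kappa> * \<epsilon> powr (2 powr (- real 0)))"
    using \<open>M \<ge> 0\<close> unfolding F1 by (intro exI[of _ M]) simp
  moreover have "subspace UNIV" "F 1 = (\<lambda>y. jp y y) ` UNIV"
    unfolding F1 cone_of_squares_def by simp_all
  ultimately show ?case unfolding add_0 by blast
next
  case (Suc k)
  have zk: "z (k + 1) \<in> dual_cone (F (k + 1))" "z (k + 1) \<in> L\<^sup>\<bottom> \<inter> {a}\<^sup>\<bottom>"
    and FSuc: "F (Suc k + 1) = F (k + 1) \<inter> {z (k + 1)}\<^sup>\<bottom>"
    using Suc.prems[of "k + 1"] by auto
  obtain V \<kappa> where V: "subspace V" "F (k + 1) = (\<lambda>y. jp y y) ` V" and "\<kappa> \<ge> 0"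
    and \<kappa>: "\<And>x \<epsilon>. 0 < \<epsilon> \<Longrightarrow> \<epsilon> \<le> 1 \<Longrightarrow> infdist x (cone_of_squares jp) \<le> M * \<epsilon> \<Longrightarrow>
        infdist x (translate L a) \<le> \<epsilon> \<Longrightarrow> norm x \<le> \<rho> \<Longrightarrow>
        \<exists>f\<in>F (k + 1). norm (x - f) \<le> \<kappa> * \<epsilon> powr (2 powr (- real k))"
  proof -
    have "(\<exists>V. subspace V \<and> F (k + 1) = (\<lambda>y. jp y y) ` V) \<and>
    (\<exists>\<kappa>\<ge>0. \<forall>x \<epsilon>. 0 < \<epsilon> \<and> \<epsilon> \<le> 1 \<and> infdist x (cone_of_squares jp) \<le> M * \<epsilon> \<and>
        infdist x (translate L a) \<le> \<epsilon> \<and> norm x \<le> \<rho> \<longrightarrow>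
        (\<exists>f\<in>F (k + 1). norm (x - f) \<le> \<kappa> * \<epsilon> powr (2 powr (- real k))))"
      using Suc.prems by (intro Suc.IH) auto
    then show ?thesis using that by blast
  qed
  define w where "w = z (k + 1)"
  obtain c where c: "c \<ge> 0" "\<And>f. f \<in> F (k + 1) \<Longrightarrow>
      \<exists>f'\<in>F (Suc k + 1). norm (f - f') \<le> c * sqrt (f \<bullet> w * norm f)"
    using square_face_residual[OF V zk(1)] unfolding FSuc w_def by blast
  \<comment> \<open>The old residual stays, since a number in (0,1] is at most its square root. The
    rest is the square root estimate with the inner product bounded by
    \<open>norm w * (1 + \<kappa>) * s\<close> and \<open>norm f\<close> by
    \<open>\<rho> + \<kappa>\<close>.\<close>
  define C where "C = \<kappa> + c * sqrt (norm w * (1 + \<kappa>) * (\<rho> + \<kappa>))"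
  have "\<exists>f'\<in>F (Suc k + 1). norm (x - f') \<le> C * \<epsilon> powr (2 powr (- real (Suc k)))"
    if x: "0 < \<epsilon>" "\<epsilon> \<le> 1" "infdist x (cone_of_squares jp) \<le> M * \<epsilon>"
      "infdist x (translate L a) \<le> \<epsilon>" "norm x \<le> \<rho>" for x \<epsilon>
  proof -
    define s where "s = \<epsilon> powr (2 powr (- real k))"
    obtain f where f: "f \<in> F (k + 1)" "norm (x - f) \<le> \<kappa> * s"
      using \<kappa>[OF x] unfolding s_def by blast
    have s: "\<epsilon> \<le> s" "0 < s" and s1: "s \<le> 1"
      unfolding s_def using dyadic_powr_bounds[OF x(1,2)] by blast+
    have half: "sqrt s = \<epsilon> powr (2 powr (- real (Suc k)))"
    proof -
      have "sqrt s = s powr (1/2)" using s(2) by (simp add: powr_half_sqrt)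
      also have "\<dots> = \<epsilon> powr (2 powr (- real k) * (1/2))" by (simp add: s_def powr_powr)
      also have "2 powr (- real k) * (1/2) = (2::real) powr (- real k - 1)"
        by (simp add: powr_diff)
      also have "- real k - 1 = - real (Suc k)" by simp
      finally show ?thesis .
    qed
    have s_half: "s \<le> sqrt s"
      using s(2) s1 by (intro real_le_rsqrt) (simp add: power2_eq_square mult_left_le)
    have "a \<in> translate L a" using \<open>subspace L\<close> by (simp add: mem_translate subspace_0)
    then obtain y where y: "y \<in> translate L a" "norm (x - y) \<le> \<epsilon>"
      using infdist_le_imp_point[OF closed_translate[OF \<open>subspace L\<close>] _ x(4)] by blast
    have "f \<bullet> w = (x - y) \<bullet> w - (x - f) \<bullet> w"
      using exposing_vector_inner[OF zk(2) y(1)] by (simp add: w_def inner_diff_left)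
    also have "\<dots> \<le> norm (x - y) * norm w + norm (x - f) * norm w"
      using norm_cauchy_schwarz[of "x - y" w] norm_cauchy_schwarz[of "- (x - f)" w]
      by (simp add: norm_minus_commute inner_diff_left)
    also have "\<dots> \<le> s * norm w + (\<kappa> * s) * norm w"
      using y(2) f(2) s by (intro add_mono mult_right_mono) auto
    finally have fw: "f \<bullet> w \<le> norm w * (1 + \<kappa>) * s" by (simp add: algebra_simps)
    have "norm f \<le> norm x + norm (x - f)"
      using norm_triangle_sub[of f x] by (simp add: norm_minus_commute)
    also have "\<dots> \<le> \<rho> + \<kappa>"
      using x(5) f(2) mult_left_mono[OF s1 \<open>\<kappa> \<ge> 0\<close>] by simp
    finally have nf: "norm f \<le> \<rho> + \<kappa>" .
    obtain f' where f': "f' \<in> F (Suc k + 1)" "norm (f - f') \<le> c * sqrt (f \<bullet> w * norm f)"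
      using c(2)[OF f(1)] by blast
    have "f \<bullet> w * norm f \<le> norm w * (1 + \<kappa>) * s * (\<rho> + \<kappa>)"
      using fw nf \<open>\<kappa> \<ge> 0\<close> s(2) by (intro mult_mono) auto
    then have "sqrt (f \<bullet> w * norm f) \<le> sqrt (norm w * (1 + \<kappa>) * (\<rho> + \<kappa>)) * sqrt s"
      by (simp add: mult_ac flip: real_sqrt_mult)
    then have "norm (f - f') \<le> c * (sqrt (norm w * (1 + \<kappa>) * (\<rho> + \<kappa>)) * sqrt s)"
      using f'(2) c(1) by (meson mult_left_mono order_trans)
    moreover have "norm (x - f) \<le> \<kappa> * sqrt s"
      using f(2) s_half \<open>\<kappa> \<ge> 0\<close> by (meson mult_left_mono order_trans)
    moreover have "norm (x - f') \<le> norm (x - f) + norm (f - f')"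
      using norm_triangle_ineq[of "x - f" "f - f'"] by simp
    ultimately have "norm (x - f') \<le> C * sqrt s"
      by (simp add: C_def algebra_simps)
    then show ?thesis using f'(1) unfolding half by blast
  qed
  moreover have "C \<ge> 0" using \<open>\<kappa> \<ge> 0\<close> c(1) \<open>\<rho> \<ge> 0\<close> by (simp add: C_def)
  moreover have "\<exists>V. subspace V \<and> F (Suc k + 1) = (\<lambda>y. jp y y) ` V"
    unfolding FSuc by (rule square_face_exposed[OF V zk(1)])
  ultimately show ?case by blast
qed

text \<open>With \<open>s\<close> the power of \<open>\<epsilon>\<close> reached at the last face,
  \<open>(1 + \<kappa>) * s\<close> bounds the distances to that face and to the affine space, so
  the regularity result applies with this number in place of \<open>\<epsilon>\<close>;
  \<open>1 + \<kappa>\<close> is the range it must cover.\<close>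

lemma facial_reduction_error_bound:
  assumes "subspace L" "M \<ge> 0" "\<rho> \<ge> 0" and "facial_reduction_PPS (cone_of_squares jp) L a k"
  shows "\<exists>\<kappa>\<ge>0. \<forall>x \<epsilon>. 0 < \<epsilon> \<and> \<epsilon> \<le> 1 \<and> infdist x (cone_of_squares jp) \<le> M * \<epsilon> \<and>
        infdist x (translate L a) \<le> \<epsilon> \<and> norm x \<le> \<rho> \<longrightarrow>
        infdist x (translate L a \<inter> cone_of_squares jp) \<le> \<kappa> * \<epsilon> powr (2 powr (- real k))"
proof -
  obtain F z where F: "F 1 = cone_of_squares jp"
    "\<And>i. i \<in> {1..k} \<Longrightarrow> z i \<in> dual_cone (F i) \<inter> L\<^sup>\<bottom> \<inter> {a}\<^sup>\<bottom> \<and> F (i + 1) = F i \<inter> {z i}\<^sup>\<bottom>"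
    "PPS (F (k + 1)) L a"
    using assms(4) unfolding facial_reduction_PPS_def by blast
  obtain \<kappa> where \<kappa>: "\<kappa> \<ge> 0" "\<And>x \<epsilon>. 0 < \<epsilon> \<Longrightarrow> \<epsilon> \<le> 1 \<Longrightarrow> infdist x (cone_of_squares jp) \<le> M * \<epsilon> \<Longrightarrow>
        infdist x (translate L a) \<le> \<epsilon> \<Longrightarrow> norm x \<le> \<rho> \<Longrightarrow>
        \<exists>f\<in>F (k + 1). norm (x - f) \<le> \<kappa> * \<epsilon> powr (2 powr (- real k))"
    using conjunct2[OF facial_chain_residual[OF assms(1-3) F(1,2)]] by blast
  obtain c where c: "c \<ge> 0" "\<And>x \<epsilon>. 0 < \<epsilon> \<Longrightarrow> \<epsilon> \<le> 1 + \<kappa> \<Longrightarrow> infdist x (F (k + 1)) \<le> \<epsilon> \<Longrightarrow>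
      infdist x (translate L a) \<le> \<epsilon> \<Longrightarrow> norm x \<le> \<rho> \<Longrightarrow> infdist x (translate L a \<inter> F (k + 1)) \<le> c * \<epsilon>"
    using PPS_bounded_linear_regularity[OF F(3) assms(1), of "1 + \<kappa>" \<rho>] by blast
  have sub: "F (k + 1) \<subseteq> cone_of_squares jp"
    using facial_chain_subset[of k F] F(1,2) by auto
  \<comment> \<open>The Slater point is a witness. Since \<open>infdist\<close> to an empty set is 0
    by convention, passing to the larger set needs this.\<close>
  have ne: "translate L a \<inter> F (k + 1) \<noteq> {}"
    using F(3) unfolding PPS_def using rel_interior_subset by blast
  have "infdist x (translate L a \<inter> cone_of_squares jp) \<le> (c * (1 + \<kappa>)) * \<epsilon> powr (2 powr (- real k))"
    if x: "0 < \<epsilon>" "\<epsilon> \<le> 1" "infdist x (cone_of_squares jp) \<le> M * \<epsilon>"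
      "infdist x (translate L a) \<le> \<epsilon>" "norm x \<le> \<rho>" for x \<epsilon>
  proof -
    define s where "s = \<epsilon> powr (2 powr (- real k))"
    obtain f where f: "f \<in> F (k + 1)" "norm (x - f) \<le> \<kappa> * s"
      using \<kappa>(2)[OF x] unfolding s_def by blast
    have s: "\<epsilon> \<le> s" "0 < s" and s1: "s \<le> 1"
      unfolding s_def using dyadic_powr_bounds[OF x(1,2)] by blast+
    have le: "\<kappa> * s \<le> (1 + \<kappa>) * s" "\<epsilon> \<le> (1 + \<kappa>) * s"
      using s mult_nonneg_nonneg[of \<kappa> s] \<kappa>(1) unfolding distrib_right by linarith+
    have "infdist x (translate L a \<inter> cone_of_squares jp) \<le> infdist x (translate L a \<inter> F (k + 1))"
      using sub ne by (intro infdist_mono) auto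
    also have "\<dots> \<le> c * ((1 + \<kappa>) * s)"
    proof (rule c(2))
      show "0 < (1 + \<kappa>) * s" using s(2) \<kappa>(1) by simp
      show "(1 + \<kappa>) * s \<le> 1 + \<kappa>" using s1 \<kappa>(1) by (intro mult_left_le) auto
      show "infdist x (F (k + 1)) \<le> (1 + \<kappa>) * s"
        using infdist_le2[OF f(1)] f(2) le(1) by (simp add: dist_norm)
      show "infdist x (translate L a) \<le> (1 + \<kappa>) * s" using x(4) le(2) by linarith
    qed (rule x(5))
    finally show ?thesis by (simp add: s_def mult_ac)
  qed
  moreover have "c * (1 + \<kappa>) \<ge> 0" using c(1) \<kappa>(1) by simp
  ultimately show ?thesis by blast
qed

text \<open>Termination makes the least \<open>k\<close> an attained one. Negative
  \<open>\<epsilon>\<close> is excluded by the distance hypothesis, \<open>\<epsilon> = 0\<close> is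
  treated apart, and \<open>\<kappa> + 1\<close> makes the constant positive.\<close>

lemma d_PPS_error_bound:
  assumes "subspace L" "M \<ge> 0" "\<rho> \<ge> 0" and feas: "cone_of_squares jp \<inter> translate L a \<noteq> {}"
  shows "\<exists>\<kappa>>0. \<forall>x \<epsilon>. \<epsilon> \<le> 1 \<and> infdist x (cone_of_squares jp) \<le> M * \<epsilon> \<and>
        infdist x (translate L a) \<le> \<epsilon> \<and> norm x \<le> \<rho> \<longrightarrow>
        infdist x (translate L a \<inter> cone_of_squares jp)
          \<le> \<kappa> * \<epsilon> powr (2 powr (- real (d_PPS (cone_of_squares jp) L a)))"
proof -
  define d where "d = d_PPS (cone_of_squares jp) L a"
  have "facial_reduction_PPS (cone_of_squares jp) L a d"
    unfolding d_def d_PPS_def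
    using facial_reduction_PPS_exists[OF _ _ _ assms(1) feas] cone_of_squares_closed_convex_cone
    by (auto intro: LeastI)
  then obtain \<kappa> where \<kappa>: "\<kappa> \<ge> 0" "\<And>x \<epsilon>. 0 < \<epsilon> \<Longrightarrow> \<epsilon> \<le> 1 \<Longrightarrow> infdist x (cone_of_squares jp) \<le> M * \<epsilon> \<Longrightarrow>
        infdist x (translate L a) \<le> \<epsilon> \<Longrightarrow> norm x \<le> \<rho> \<Longrightarrow>
        infdist x (translate L a \<inter> cone_of_squares jp) \<le> \<kappa> * \<epsilon> powr (2 powr (- real d))"
    using facial_reduction_error_bound[OF assms(1-3)] by blast
  have "infdist x (translate L a \<inter> cone_of_squares jp) \<le> (\<kappa> + 1) * \<epsilon> powr (2 powr (- real d))"
    if x: "\<epsilon> \<le> 1" "infdist x (cone_of_squares jp) \<le> M * \<epsilon>"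
      "infdist x (translate L a) \<le> \<epsilon>" "norm x \<le> \<rho>" for x \<epsilon>
  proof -
    have "0 \<le> \<epsilon>" using x(3) infdist_nonneg order_trans by blast
    then consider "0 < \<epsilon>" | "\<epsilon> = 0" by linarith
    then show ?thesis
    proof cases
      case 1
      have "infdist x (translate L a \<inter> cone_of_squares jp) \<le> \<kappa> * \<epsilon> powr (2 powr (- real d))"
        using \<kappa>(2)[OF 1 x] .
      also have "\<dots> \<le> (\<kappa> + 1) * \<epsilon> powr (2 powr (- real d))"
        by (intro mult_right_mono) auto
      finally show ?thesis .
    next
      \<comment> \<open>Here \<open>0 powr p\<close> is 0, so the claim says that \<open>x\<close>
        is at distance 0 from the intersection; closedness of both sets even puts it inside.\<close>
      case 2
      then have "infdist x (cone_of_squares jp) = 0" "infdist x (translate L a) = 0"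
        using x(2,3) infdist_nonneg[of x] by (auto intro: order_antisym)
      then have "x \<in> cone_of_squares jp" "x \<in> translate L a"
        using in_closed_iff_infdist_zero[OF cone_of_squares_closed_convex_cone(1)]
          in_closed_iff_infdist_zero[OF closed_translate[OF assms(1)]] feas by blast+
      then show ?thesis using 2 by simp
    qed
  qed
  then show ?thesis
    using \<kappa>(1) by (intro exI[of _ "\<kappa> + 1"]) (auto simp: d_def)
qed

end

theorem proposition38:
  fixes jp :: "'a::euclidean_space \<Rightarrow> 'a \<Rightarrow> 'a" and e a :: 'a and L :: "'a set" and \<rho> :: real
  assumes "euclidean_jordan_algebra jp e"
    and "\<And>x y. x \<bullet> y = jtrace jp e (jp x y)"
    and "subspace L"
    and "cone_of_squares jp \<inter> translate L a \<noteq> {}"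
    and "\<rho> > 0"
  shows "(\<exists>\<kappa>>0. \<forall>(x::'a) (\<epsilon>::real).
            \<epsilon> \<le> 1 \<and> infdist x (cone_of_squares jp) \<le> \<epsilon> \<and>
            infdist x (translate L a) \<le> \<epsilon> \<and> norm x \<le> \<rho> \<longrightarrow>
            infdist x (translate L a \<inter> cone_of_squares jp)
              \<le> \<kappa> * \<epsilon> powr (2 powr (- real (d_PPS (cone_of_squares jp) L a)))) \<and>
         (\<exists>\<kappa>>0. \<forall>(x::'a) (\<epsilon>::real).
            \<epsilon> \<le> 1 \<and> lambda_min jp e x \<ge> - \<epsilon> \<and>
            infdist x (translate L a) \<le> \<epsilon> \<and> norm x \<le> \<rho> \<longrightarrow>
            infdist x (translate L a \<inter> cone_of_squares jp)
              \<le> \<kappa> * \<epsilon> powr (2 powr (- real (d_PPS (cone_of_squares jp) L a))))"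
proof -
  interpret euclidean_jordan_algebra jp e by fact
  have \<rho>: "\<rho> \<ge> 0" using assms(5) by simp
  have lam: "infdist x (cone_of_squares jp) \<le> norm e * \<epsilon>"
    if "- \<epsilon> \<le> lambda_min jp e x" "infdist x (translate L a) \<le> \<epsilon>" for x \<epsilon>
    using infdist_cone_of_squares_le[OF that(1)] that(2) infdist_nonneg order_trans by blast
  show ?thesis
  proof (rule conjI)
    show "\<exists>\<kappa>>0. \<forall>(x::'a) (\<epsilon>::real).
            \<epsilon> \<le> 1 \<and> infdist x (cone_of_squares jp) \<le> \<epsilon> \<and>
            infdist x (translate L a) \<le> \<epsilon> \<and> norm x \<le> \<rho> \<longrightarrow>
            infdist x (translate L a \<inter> cone_of_squares jp)
              \<le> \<kappa> * \<epsilon> powr (2 powr (- real (d_PPS (cone_of_squares jp) L a)))"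
      using d_PPS_error_bound[OF assms(3) zero_le_one \<rho> assms(4)] by simp
  next
    obtain \<kappa> where "\<kappa> > 0" and \<kappa>: "\<And>x \<epsilon>. \<epsilon> \<le> 1 \<Longrightarrow> infdist x (cone_of_squares jp) \<le> norm e * \<epsilon> \<Longrightarrow>
        infdist x (translate L a) \<le> \<epsilon> \<Longrightarrow> norm x \<le> \<rho> \<Longrightarrow>
        infdist x (translate L a \<inter> cone_of_squares jp)
          \<le> \<kappa> * \<epsilon> powr (2 powr (- real (d_PPS (cone_of_squares jp) L a)))"
      using d_PPS_error_bound[OF assms(3) norm_ge_zero \<rho> assms(4), of e] by blast
    then show "\<exists>\<kappa>>0. \<forall>(x::'a) (\<epsilon>::real).
            \<epsilon> \<le> 1 \<and> lambda_min jp e x \<ge> - \<epsilon> \<and>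
            infdist x (translate L a) \<le> \<epsilon> \<and> norm x \<le> \<rho> \<longrightarrow>
            infdist x (translate L a \<inter> cone_of_squares jp)
              \<le> \<kappa> * \<epsilon> powr (2 powr (- real (d_PPS (cone_of_squares jp) L a)))"
      using lam by (intro exI[of _ \<kappa>]) blast
  qed
qed

end
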